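(* For every integer $c\ge 2$, \textsc{$c$-Closed Vertex Deletion} can be solved in $(c+1)^{\mathrm{nd}(G)}\cdot n^{\mathcal{O}(1)}$ time, where $n$ is the number of vertices of the input graph $G$ and $\mathrm{nd}(G)$ is its neighborhood diversity.
   Context: A graph is $c$-closed if every pair of distinct nonadjacent vertices has at most $c-1$ common neighbors. \textsc{$c$-Closed Vertex Deletion}: given a graph $G=(V,E)$ and a positive integer $k$, decide whether there is $S\subseteq V$ with $|S|\le k$ such that $G-S$ is $c$-closed. The neighborhood diversity $\mathrm{nd}(G)$ is the number of equivalence classes of the relation $u\sim v \iff N(u)\setminus\{v\}=N(v)\setminus\{u\}$ on $V(G)$. *)

theory Defs
  imports Complex_Main "HOL-Library.Landau_Symbols"
begin

type_synonym 'v graph = "'v set \<times> 'v set set"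

definition verts :: "'v graph \<Rightarrow> 'v set" where
  "verts G = fst G"

definition edges :: "'v graph \<Rightarrow> 'v set set" where
  "edges G = snd G"

definition simple_graph :: "'v graph \<Rightarrow> bool" where
  "simple_graph G \<longleftrightarrow> finite (verts G) \<and> (\<forall>e\<in>edges G. e \<subseteq> verts G \<and> card e = 2)"

definition nbhd :: "'v graph \<Rightarrow> 'v \<Rightarrow> 'v set" where
  "nbhd G u = {v \<in> verts G. {u, v} \<in> edges G}"

definition c_closed :: "nat \<Rightarrow> 'v graph \<Rightarrow> bool" where
  "c_closed c G \<longleftrightarrow>
     (\<forall>u\<in>verts G. \<forall>v\<in>verts G. u \<noteq> v \<longrightarrow> {u, v} \<notin> edges G \<longrightarrow>
        card (nbhd G u \<inter> nbhd G v) \<le> c - 1)"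

definition delete_verts :: "'v graph \<Rightarrow> 'v set \<Rightarrow> 'v graph" where
  "delete_verts G S = (verts G - S, {e \<in> edges G. e \<inter> S = {}})"

definition closed_vertex_deletion :: "nat \<Rightarrow> 'v graph \<Rightarrow> nat \<Rightarrow> bool" where
  "closed_vertex_deletion c G k \<longleftrightarrow>
     (\<exists>S. S \<subseteq> verts G \<and> card S \<le> k \<and> c_closed c (delete_verts G S))"

definition same_type :: "'v graph \<Rightarrow> ('v \<times> 'v) set" where
  "same_type G = {(u, v). u \<in> verts G \<and> v \<in> verts G \<and> nbhd G u - {v} = nbhd G v - {u}}"

definition nd :: "'v graph \<Rightarrow> nat" where
  "nd G = card (verts G // same_type G)"

text \<open>
  The machine model is a random access machine with structured control flow. A program refers to
  finitely many registers and finitely many arrays of unbounded length, all holding natural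
  numbers, and every elementary operation or test takes one time step.
  The only arithmetic operations are successor and predecessor. With addition or multiplication
  at unit cost, \<open>t\<close> steps could build and manipulate numbers with \<open>t\<close> or more bits;
  here a number grows by at most one per step, so the unit-cost measure is a realistic one.
\<close>

datatype test =
    Eq_test nat nat
  | Less_test nat nat

datatype prog =
    Const nat nat         \<comment> \<open>\<open>r := m\<close>\<close>
  | Copy nat nat          \<comment> \<open>\<open>r := r'\<close>\<close>
  | Incr nat
  | Decr nat
  | Load nat nat nat      \<comment> \<open>\<open>r := a[i]\<close>, index in register \<open>i\<close>\<close>
  | Store nat nat nat     \<comment> \<open>\<open>a[i] := r\<close>, index in register \<open>i\<close>\<close>
  | Seq prog prog
  | Cond test prog prog
  | Loop test prog

type_synonym state = "(nat \<Rightarrow> nat) \<times> (nat \<Rightarrow> nat \<Rightarrow> nat)"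

fun holds :: "test \<Rightarrow> state \<Rightarrow> bool" where
  "holds (Eq_test r r') (R, A) \<longleftrightarrow> R r = R r'"
| "holds (Less_test r r') (R, A) \<longleftrightarrow> R r < R r'"

text \<open>\<open>exec p s t s'\<close>: started in state \<open>s\<close>, program \<open>p\<close> halts after exactly \<open>t\<close> steps in
  state \<open>s'\<close>.\<close>

inductive exec :: "prog \<Rightarrow> state \<Rightarrow> nat \<Rightarrow> state \<Rightarrow> bool" where
  exec_Const: "exec (Const r m) (R, A) 1 (R(r := m), A)"
| exec_Copy: "exec (Copy r r') (R, A) 1 (R(r := R r'), A)"
| exec_Incr: "exec (Incr r) (R, A) 1 (R(r := R r + 1), A)"
| exec_Decr: "exec (Decr r) (R, A) 1 (R(r := R r - 1), A)"
| exec_Load: "exec (Load r a i) (R, A) 1 (R(r := A a (R i)), A)"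
| exec_Store: "exec (Store a i r) (R, A) 1 (R, A(a := (A a)(R i := R r)))"
| exec_Seq: "exec p s t s' \<Longrightarrow> exec q s' t' s'' \<Longrightarrow> exec (Seq p q) s (t + t') s''"
| exec_Cond_true: "holds b s \<Longrightarrow> exec p s t s' \<Longrightarrow> exec (Cond b p q) s (1 + t) s'"
| exec_Cond_false: "\<not> holds b s \<Longrightarrow> exec q s t s' \<Longrightarrow> exec (Cond b p q) s (1 + t) s'"
| exec_Loop_false: "\<not> holds b s \<Longrightarrow> exec (Loop b p) s 1 s"
| exec_Loop_true: "holds b s \<Longrightarrow> exec p s t s' \<Longrightarrow> exec (Loop b p) s' t' s''
    \<Longrightarrow> exec (Loop b p) s (1 + t + t') s''"

inductive_cases exec_ConstE: "exec (Const r m) s t s'"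
inductive_cases exec_CopyE: "exec (Copy r r') s t s'"
inductive_cases exec_IncrE: "exec (Incr r) s t s'"
inductive_cases exec_DecrE: "exec (Decr r) s t s'"
inductive_cases exec_LoadE: "exec (Load r a i) s t s'"
inductive_cases exec_StoreE: "exec (Store a i r) s t s'"
inductive_cases exec_SeqE: "exec (Seq p q) s t s'"
inductive_cases exec_CondE: "exec (Cond b p q) s t s'"
inductive_cases exec_LoopE: "exec (Loop b p) s t s'"

lemma exec_deterministic:
  "exec p s t s' \<Longrightarrow> exec p s u s'' \<Longrightarrow> t = u \<and> s' = s''"
proof (induction arbitrary: u s'' rule: exec.induct)
  case (exec_Seq p s t s' q t' s1)
  obtain v r v' where "u = v + v'" "exec p s v r" "exec q r v' s''"
    using exec_Seq.prems by (rule exec_SeqE)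
  with exec_Seq.IH(1)[of v r] exec_Seq.IH(2)[of v' s''] show ?case by simp
next
  case (exec_Cond_true b s p t s' q)
  obtain v where "u = 1 + v" "exec p s v s''"
    using exec_Cond_true.prems exec_Cond_true.hyps(1) by (auto elim: exec_CondE)
  with exec_Cond_true.IH[of v s''] show ?case by simp
next
  case (exec_Cond_false b s q t s' p)
  obtain v where "u = 1 + v" "exec q s v s''"
    using exec_Cond_false.prems exec_Cond_false.hyps(1) by (auto elim: exec_CondE)
  with exec_Cond_false.IH[of v s''] show ?case by simp
next
  case (exec_Loop_false b s p)
  from exec_Loop_false.prems show ?case
    using exec_Loop_false.hyps by (auto elim: exec_LoopE)
next
  case (exec_Loop_true b s p t s' t' s1)
  obtain v r v' where "u = 1 + v + v'" "exec p s v r" "exec (Loop b p) r v' s''"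
    using exec_Loop_true.prems exec_Loop_true.hyps(1) by (auto elim: exec_LoopE)
  with exec_Loop_true.IH(1)[of v r] exec_Loop_true.IH(2)[of v' s''] show ?case by simp
next
  case (exec_Const r m R A)
  then show ?case by (auto elim: exec_ConstE)
next
  case (exec_Copy r r' R A)
  then show ?case by (auto elim: exec_CopyE)
next
  case (exec_Incr r R A)
  then show ?case by (auto elim: exec_IncrE)
next
  case (exec_Decr r R A)
  then show ?case by (auto elim: exec_DecrE)
next
  case (exec_Load r a i R A)
  then show ?case by (auto elim: exec_LoadE)
next
  case (exec_Store a i r R A)
  then show ?case by (auto elim: exec_StoreE)
qed

text \<open>A graph on the vertices \<open>0, \<dots>, n - 1\<close> is given by \<open>n\<close> in register 0 and its adjacency matrix,
  row by row, in array 0; the number \<open>k\<close> is given in register 1.\<close>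

definition input_state :: "nat graph \<Rightarrow> nat \<Rightarrow> state" where
  "input_state G k =
     (let n = card (verts G) in
      ((\<lambda>_. 0)(0 := n, 1 := k),
       (\<lambda>_ _. 0)(0 := (\<lambda>i. if i < n * n \<and> {i div n, i mod n} \<in> edges G then 1 else 0))))"

definition solves_within ::
  "prog \<Rightarrow> (nat graph \<Rightarrow> nat \<Rightarrow> bool) \<Rightarrow> (nat graph \<Rightarrow> nat) \<Rightarrow> bool" where
  "solves_within p Q T \<longleftrightarrow>
     (\<forall>G k. simple_graph G \<longrightarrow> verts G = {..<card (verts G)} \<longrightarrow> k > 0 \<longrightarrow>
        (\<exists>t R A. exec p (input_state G k) t (R, A) \<and> t \<le> T G \<and>
           R 0 = (if Q G k then 1 else 0)))"

text \<open>The functions of the form \<open>n\<close> to the power \<open>\<O>(1)\<close>.\<close>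

definition poly_bounded :: "(nat \<Rightarrow> nat) \<Rightarrow> bool" where
  "poly_bounded f \<longleftrightarrow> (\<exists>d::nat. (\<lambda>n. real (f n)) \<in> O(\<lambda>n. real n ^ d))"

end

theory Submission
  imports Defs
begin

text \<open>
  Twins can be exchanged, so whether \<open>G - S\<close> is \<open>c\<close>-closed depends only on how many vertices of
  each twin class are kept. If at least \<open>c\<close> vertices of a class are kept in a \<open>c\<close>-closed graph, then
  the class lies in no common neighbourhood of two nonadjacent vertices, and all of it may be kept.
  This leaves \<open>c + 1\<close> choices per class: keep exactly the first \<open>d\<close> vertices for some
  \<open>d < c\<close>, or keep the whole class. A counter in base \<open>c + 1\<close> with one digit per class runs
  through all choices, and each of them is checked in polynomial time.
\<close>

subsection \<open>Running programs within a time bound\<close>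

text \<open>A class inside a common neighbourhood is harmless to enlarge for the following reason. A
  common neighbour \<open>w\<close> of nonadjacent \<open>u\<close>, \<open>v\<close> is a twin of
  neither, since exchanging \<open>w\<close> for \<open>u\<close> would turn the edge
  \<open>w v\<close> into \<open>u v\<close>. So every kept twin of \<open>w\<close> is a common
  neighbour as well, and \<open>c\<close> of them would already violate closedness. The machine has
  only successor and predecessor, and neither the number of classes nor the number of choices is
  given. Hence every graph notion is rephrased by counting over \<open>{..<n}\<close>: a class is
  represented by its least vertex and numbered by how many representatives are smaller, and both are
  recomputed whenever they are needed. The bound \<open>(c + 1) ^ nd G\<close> is never computed;
  the loop stops once all class digits equal \<open>c\<close>. The budget \<open>k\<close> may be
  huge compared with \<open>n\<close>, but it enters only through a comparison, so the cost of one
  round is bounded in terms of \<open>n\<close> alone.\<close>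

definition runs :: "prog \<Rightarrow> state \<Rightarrow> nat \<Rightarrow> (state \<Rightarrow> bool) \<Rightarrow> bool" where
  "runs p s B Q \<longleftrightarrow> (\<exists>t s'. exec p s t s' \<and> t \<le> B \<and> Q s')"

lemma runs_mono:
  assumes "runs p s B Q" "B \<le> B'" "\<And>s'. Q s' \<Longrightarrow> Q' s'"
  shows "runs p s B' Q'"
  using assms unfolding runs_def by (meson order_trans)

lemma runs_Const: "Q (R(r := m), A) \<Longrightarrow> runs (Const r m) (R, A) 1 Q"
  unfolding runs_def using exec_Const by blast

lemma runs_Copy: "Q (R(r := R r'), A) \<Longrightarrow> runs (Copy r r') (R, A) 1 Q"
  unfolding runs_def using exec_Copy by blast

lemma runs_Incr: "Q (R(r := Suc (R r)), A) \<Longrightarrow> runs (Incr r) (R, A) 1 Q"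
  unfolding runs_def using exec_Incr[of r R A] by auto

lemma runs_Load: "Q (R(r := A a (R i)), A) \<Longrightarrow> runs (Load r a i) (R, A) 1 Q"
  unfolding runs_def using exec_Load by blast

lemma runs_Store: "Q (R, A(a := (A a)(R i := R r))) \<Longrightarrow> runs (Store a i r) (R, A) 1 Q"
  unfolding runs_def using exec_Store by blast

lemma runs_Seq:
  assumes "runs p s B (\<lambda>s'. runs q s' B' Q)"
  shows "runs (Seq p q) s (B + B') Q"
  using assms unfolding runs_def by (meson add_mono exec_Seq)

text \<open>Charging the sum of both branches instead of the maximum keeps all bounds inside sums
  and products, for which polynomial growth is immediate.\<close>

lemma runs_Cond:
  assumes "holds b s \<Longrightarrow> runs p s B Q" "\<not> holds b s \<Longrightarrow> runs q s B' Q"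
  shows "runs (Cond b p q) s (1 + (B + B')) Q"
proof (cases "holds b s")
  case True
  then obtain t s' where "exec p s t s'" "t \<le> B" "Q s'"
    using assms(1) unfolding runs_def by blast
  then show ?thesis using exec_Cond_true[OF True] unfolding runs_def
    by (metis add_left_mono trans_le_add1)
next
  case False
  then obtain t s' where "exec q s t s'" "t \<le> B'" "Q s'"
    using assms(2) unfolding runs_def by blast
  then show ?thesis using exec_Cond_false[OF False] unfolding runs_def
    by (metis add_left_mono trans_le_add2)
qed

text \<open>The iteration number is a ghost parameter of \<open>I\<close>, so no register has to
  hold it. This matters for the main loop, whose number of rounds is exponential in
  \<open>nd G\<close>.\<close>

lemma runs_Loop:
  assumes "I j s" "j \<le> (N::nat)"
    and step: "\<And>i s. j \<le> i \<Longrightarrow> i < N \<Longrightarrow> I i s \<Longrightarrow> holds b s \<and> runs p s B (I (Suc i))"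
    and stop: "\<And>s. I N s \<Longrightarrow> \<not> holds b s \<and> Q s"
  shows "runs (Loop b p) s ((N - j) * (B + 1) + 1) Q"
  using assms(2,1) step
proof (induction arbitrary: s rule: inc_induct)
  case base
  then have "exec (Loop b p) s 1 s" "Q s" using stop exec_Loop_false by blast+
  then show ?case unfolding runs_def by (intro exI[of _ 1] exI[of _ s]) simp
next
  case (step i)
  have h: "holds b s" and "runs p s B (I (Suc i))"
    using step.prems(2)[of i s] step.prems(1) step.hyps by auto
  then obtain t s' where 1: "exec p s t s'" "t \<le> B" "I (Suc i) s'" unfolding runs_def by blast
  have "runs (Loop b p) s' ((N - Suc i) * (B + 1) + 1) Q"
    using step.prems(2) by (rule step.IH[OF 1(3)]) simp_all
  then obtain t' s'' where 2: "exec (Loop b p) s' t' s''" "t' \<le> (N - Suc i) * (B + 1) + 1" "Q s''"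
    unfolding runs_def by blast
  have "N - i = Suc (N - Suc i)" using step.hyps by simp
  then have "1 + t + t' \<le> (N - i) * (B + 1) + 1" using 1 2 by simp
  then show ?case using exec_Loop_true[OF h 1(1) 2(1)] 2(3) unfolding runs_def by blast
qed

definition For :: "nat \<Rightarrow> prog \<Rightarrow> prog" where
  "For x p = Seq (Const x 0) (Loop (Less_test x 0) (Seq p (Incr x)))"

text \<open>\<open>For\<close> increments \<open>x\<close> after the body, hence
  \<open>I (Suc i)\<close> is demanded of the register file with \<open>x\<close> already advanced,
  while the body itself must leave \<open>x\<close> and register \<open>0\<close> unchanged.\<close>

lemma runs_For:
  assumes "R 0 = n" "x \<noteq> 0" "I 0 (R(x := 0)) A"
    and step: "\<And>i R A. i < n \<Longrightarrow> R 0 = n \<Longrightarrow> R x = i \<Longrightarrow> I i R A \<Longrightarrow>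
      runs p (R, A) B (\<lambda>(R', A'). R' 0 = n \<and> R' x = i \<and> I (Suc i) (R'(x := Suc i)) A')"
    and stop: "\<And>R A. R 0 = n \<Longrightarrow> R x = n \<Longrightarrow> I n R A \<Longrightarrow> Q (R, A)"
  shows "runs (For x p) (R, A) (1 + (n * (B + 2) + 1)) Q"
proof -
  define J where "J i = (\<lambda>(R, A). R 0 = n \<and> R x = i \<and> I i R A)" for i
  have body: "holds (Less_test x 0) s \<and> runs (Seq p (Incr x)) s (B + 1) (J (Suc i))"
    if "i < n" "J i s" for i s
  proof -
    obtain R A where s: "s = (R, A)" by force
    with that have "R 0 = n" "R x = i" "I i R A" by (auto simp: J_def)
    note r = step[OF that(1) this]
    have "runs (Seq p (Incr x)) (R, A) (B + 1) (J (Suc i))"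
      by (rule runs_Seq, rule runs_mono[OF r order_refl], clarify, rule runs_Incr)
        (use \<open>x \<noteq> 0\<close> in \<open>auto simp: J_def\<close>)
    then show ?thesis using s \<open>R 0 = n\<close> \<open>R x = i\<close> that by simp
  qed
  have "runs (Loop (Less_test x 0) (Seq p (Incr x))) (R(x := 0), A) ((n - 0) * (B + 1 + 1) + 1) Q"
    by (rule runs_Loop[where I = J]) (use assms body in \<open>auto simp: J_def\<close>)
  then show ?thesis unfolding For_def
    by (intro runs_Seq runs_Const) simp
qed

subsection \<open>Compiling expressions\<close>

text \<open>All quantities the algorithm needs are values of expressions of this small language, in which
  counting over the range \<open>{..<n}\<close> is the only binder, so that every expression is evaluated in
  polynomial time. Variables are registers, and register \<open>0\<close> holds \<open>n\<close>. The indices in \<open>Adj\<close> are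
  truncated at \<open>n\<close> to make the running time independent of their values.\<close>

datatype ex =
    V nat
  | N nat
  | Sc ex
  | Lt ex ex
  | Ite ex ex ex
  | Ld nat ex
  | Adj nat nat
  | Cnt nat ex

fun val :: "ex \<Rightarrow> (nat \<Rightarrow> nat) \<Rightarrow> (nat \<Rightarrow> nat \<Rightarrow> nat) \<Rightarrow> nat" where
  "val (V x) R A = R x"
| "val (N m) R A = m"
| "val (Sc e) R A = Suc (val e R A)"
| "val (Lt e e') R A = (if val e R A < val e' R A then 1 else 0)"
| "val (Ite e e1 e0) R A = (if val e R A \<noteq> 0 then val e1 R A else val e0 R A)"
| "val (Ld a e) R A = A a (val e R A)"
| "val (Adj x y) R A = A 0 (min (R x) (R 0) * R 0 + min (R y) (R 0))"
| "val (Cnt x e) R A = card {i. i < R 0 \<and> val e (R(x := i)) A \<noteq> 0}"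

fun wf_ex :: "nat \<Rightarrow> ex \<Rightarrow> bool" where
  "wf_ex t (V x) \<longleftrightarrow> x < t"
| "wf_ex t (N m) \<longleftrightarrow> True"
| "wf_ex t (Sc e) \<longleftrightarrow> wf_ex t e"
| "wf_ex t (Lt e e') \<longleftrightarrow> wf_ex t e \<and> wf_ex t e'"
| "wf_ex t (Ite e e1 e0) \<longleftrightarrow> wf_ex t e \<and> wf_ex t e1 \<and> wf_ex t e0"
| "wf_ex t (Ld a e) \<longleftrightarrow> wf_ex t e"
| "wf_ex t (Adj x y) \<longleftrightarrow> x < t \<and> y < t"
| "wf_ex t (Cnt x e) \<longleftrightarrow> 0 < x \<and> x < t \<and> wf_ex t e"

fun arrs :: "ex \<Rightarrow> nat set" where
  "arrs (V x) = {}"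
| "arrs (N m) = {}"
| "arrs (Sc e) = arrs e"
| "arrs (Lt e e') = arrs e \<union> arrs e'"
| "arrs (Ite e e1 e0) = arrs e \<union> arrs e1 \<union> arrs e0"
| "arrs (Ld a e) = insert a (arrs e)"
| "arrs (Adj x y) = {0}"
| "arrs (Cnt x e) = arrs e"

text \<open>The result goes to register \<open>t\<close>, and scratch space lies above it, so
  variables below \<open>t\<close> survive. \<open>Copy x x\<close> is a no-op for empty branches.
  \<open>Cnt\<close> saves its variable in \<open>t\<close> and restores it at the end.
  \<open>Adj\<close> builds the matrix index by repeated increments, as there is no
  multiplication.\<close>

fun compile :: "ex \<Rightarrow> nat \<Rightarrow> prog" where
  "compile (V x) t = Copy t x"
| "compile (N m) t = Const t m"
| "compile (Sc e) t = Seq (compile e t) (Incr t)"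
| "compile (Lt e e') t = Seq (compile e t) (Seq (compile e' (t + 1))
     (Cond (Less_test t (t + 1)) (Const t 1) (Const t 0)))"
| "compile (Ite e e1 e0) t = Seq (compile e t) (Seq (Const (t + 1) 0)
     (Cond (Less_test (t + 1) t) (compile e1 t) (compile e0 t)))"
| "compile (Ld a e) t = Seq (compile e t) (Load t a t)"
| "compile (Adj x y) t = Seq (Const t 0)
    (Seq (For (t + 1) (Cond (Less_test (t + 1) x) (For (t + 2) (Incr t)) (Copy x x)))
    (Seq (For (t + 1) (Cond (Less_test (t + 1) y) (Incr t) (Copy x x)))
    (Load t 0 t)))"
| "compile (Cnt x e) t = Seq (Copy t x) (Seq (Const (t + 1) 0)
    (Seq (For x (Seq (compile e (t + 2)) (Seq (Const (t + 3) 0)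
      (Cond (Less_test (t + 3) (t + 2)) (Incr (t + 1)) (Copy x x)))))
    (Seq (Copy x t) (Copy t (t + 1)))))"

text \<open>The right-hand sides are left in the unsimplified shape that the \<open>runs\<close>
  rules produce for \<open>compile\<close>, so that they unify directly.\<close>

fun tm :: "ex \<Rightarrow> nat \<Rightarrow> nat" where
  "tm (V x) n = 1"
| "tm (N m) n = 1"
| "tm (Sc e) n = tm e n + 1"
| "tm (Lt e e') n = tm e n + (tm e' n + (1 + (1 + 1)))"
| "tm (Ite e e1 e0) n = tm e n + (1 + (1 + (tm e1 n + tm e0 n)))"
| "tm (Ld a e) n = tm e n + 1"
| "tm (Adj x y) n = 1 + ((1 + (n * ((1 + ((1 + (n * (1 + 2) + 1)) + 1)) + 2) + 1)) +
    ((1 + (n * ((1 + (1 + 1)) + 2) + 1)) + 1))"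
| "tm (Cnt x e) n = 1 + (1 + ((1 + (n * ((tm e n + (1 + (1 + (1 + 1)))) + 2) + 1)) + (1 + 1)))"

text \<open>Needed because later subexpressions are evaluated after scratch registers have changed.
  \<open>0 < t\<close> is required since \<open>Adj\<close> and \<open>Cnt\<close> read register
  \<open>0\<close>.\<close>

lemma val_cong:
  assumes "wf_ex t e" "0 < t" "\<And>i. i < t \<Longrightarrow> R i = R' i" "\<And>a. a \<in> arrs e \<Longrightarrow> A a = A' a"
  shows "val e R A = val e R' A'"
  using assms
proof (induction e arbitrary: R R')
  case (Cnt x e)
  have "val e (R(x := i)) A = val e (R'(x := i)) A'" for i
    by (rule Cnt.IH) (use Cnt.prems in auto)
  then show ?case using Cnt.prems by simp
next
  case (Lt e1 e2)
  have "val e1 R A = val e1 R' A'" by (rule Lt.IH) (use Lt.prems in auto)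
  moreover have "val e2 R A = val e2 R' A'" by (rule Lt.IH) (use Lt.prems in auto)
  ultimately show ?case by simp
next
  case (Ite e1 e2 e3)
  have "val e1 R A = val e1 R' A'" by (rule Ite.IH) (use Ite.prems in auto)
  moreover have "val e2 R A = val e2 R' A'" by (rule Ite.IH) (use Ite.prems in auto)
  moreover have "val e3 R A = val e3 R' A'" by (rule Ite.IH) (use Ite.prems in auto)
  ultimately show ?case by simp
next
  case (Ld a e)
  have "val e R A = val e R' A'" by (rule Ld.IH) (use Ld.prems in auto)
  then show ?case using Ld.prems by simp
next
  case (Sc e)
  have "val e R A = val e R' A'" by (rule Sc.IH) (use Sc.prems in auto)
  then show ?case by simp
qed auto

lemma wf_ex_mono: "wf_ex t e \<Longrightarrow> t \<le> t' \<Longrightarrow> wf_ex t' e"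
  by (induction e) auto

lemma card_filter_Suc:
  "card {i. i < Suc m \<and> P i} = card {i. i < m \<and> P i} + (if P m then 1 else 0)"
proof -
  have "{i. i < Suc m \<and> P i} = (if P m then insert m {i. i < m \<and> P i} else {i. i < m \<and> P i})"
    by (auto simp: less_Suc_eq)
  then show ?thesis by simp
qed

lemma runs_compile:
  assumes "wf_ex t e" "0 < t" "R 0 = n"
    and "\<And>R'. R' t = val e R A \<Longrightarrow> (\<And>i. i < t \<Longrightarrow> R' i = R i) \<Longrightarrow> Q (R', A)"
  shows "runs (compile e t) (R, A) (tm e n) Q"
  using assms
proof (induction e arbitrary: t R Q)
  case (V x)
  show ?case unfolding compile.simps tm.simps by (rule runs_Copy, rule V.prems) auto
next
  case (N m)
  show ?case unfolding compile.simps tm.simps by (rule runs_Const, rule N.prems) auto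
next
  case (Sc e)
  show ?case unfolding compile.simps tm.simps
    by (intro runs_Seq Sc.IH runs_Incr Sc.prems) (use Sc.prems in auto)
next
  case (Lt e e')
  show ?case unfolding compile.simps tm.simps
  proof (rule runs_Seq, rule Lt.IH(1))
    fix R1 assume 1: "R1 t = val e R A" "\<And>i. i < t \<Longrightarrow> R1 i = R i"
    have v: "val e' R1 A = val e' R A"
      by (rule val_cong[of t]) (use 1 Lt.prems in auto)
    show "runs (Seq (compile e' (t + 1)) (Cond (Less_test t (t + 1)) (Const t 1) (Const t 0)))
      (R1, A) (tm e' n + (1 + (1 + 1))) Q"
    proof (rule runs_Seq, rule Lt.IH(2))
      show "wf_ex (t + 1) e'" using Lt.prems wf_ex_mono by force
    next
      fix R2 assume 2: "R2 (t + 1) = val e' R1 A" "\<And>i. i < t + 1 \<Longrightarrow> R2 i = R1 i"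
      show "runs (Cond (Less_test t (t + 1)) (Const t 1) (Const t 0)) (R2, A) (1 + (1 + 1)) Q"
        by (intro runs_Cond runs_Const Lt.prems) (use 1 2 v in auto)
    qed (use 1 Lt.prems in auto)
  qed (use Lt.prems in auto)
next
  case (Ite e e1 e0)
  show ?case unfolding compile.simps tm.simps
  proof (rule runs_Seq, rule Ite.IH(1))
    fix R1 assume 1: "R1 t = val e R A" "\<And>i. i < t \<Longrightarrow> R1 i = R i"
    define R2 where "R2 = R1(t + 1 := 0)"
    have 2: "R2 t = val e R A" "R2 (t + 1) = 0" "\<And>i. i < t \<Longrightarrow> R2 i = R i"
      using 1 by (auto simp: R2_def)
    have v: "val e' R2 A = val e' R A" if "wf_ex t e'" for e'
      by (rule val_cong[of t]) (use 2 Ite.prems that in auto)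
    show "runs (Seq (Const (t + 1) 0) (Cond (Less_test (t + 1) t) (compile e1 t) (compile e0 t)))
       (R1, A) (1 + (1 + (tm e1 n + tm e0 n))) Q"
    proof (rule runs_Seq, rule runs_Const, fold R2_def, rule runs_Cond)
      assume "holds (Less_test (t + 1) t) (R2, A)"
      then show "runs (compile e1 t) (R2, A) (tm e1 n) Q"
        by (intro Ite.IH(2) Ite.prems(4)) (use 2 v Ite.prems(1-3) in simp_all)
    next
      assume "\<not> holds (Less_test (t + 1) t) (R2, A)"
      then show "runs (compile e0 t) (R2, A) (tm e0 n) Q"
        by (intro Ite.IH(3) Ite.prems(4)) (use 2 v Ite.prems(1-3) in simp_all)
    qed
  qed (use Ite.prems in auto)
next
  case (Ld a e)
  show ?case unfolding compile.simps tm.simps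
    by (intro runs_Seq Ld.IH runs_Load Ld.prems) (use Ld.prems in auto)
next
  case (Adj x y)
  \<comment> \<open>The outer loop always makes \<open>n\<close> rounds, of which only the first
    \<open>R x\<close> add \<open>n\<close>; this is where the truncation by \<open>min\<close>
    arises.\<close>
  define I1 where "I1 i R' A' \<longleftrightarrow> A' = A \<and> (\<forall>l<t. R' l = R l) \<and> R' t = min i (R x) * n"
    for i R' and A' :: "nat \<Rightarrow> nat \<Rightarrow> nat"
  define I2 where "I2 i R' A' \<longleftrightarrow> A' = A \<and> (\<forall>l<t. R' l = R l) \<and> R' t = min (R x) n * n + min i (R y)"
    for i R' and A' :: "nat \<Rightarrow> nat \<Rightarrow> nat"
  show ?case unfolding compile.simps tm.simps
  proof (rule runs_Seq, rule runs_Const, rule runs_Seq, rule runs_For[where I = I1])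
    fix i R1 A1
    assume i: "i < n" "R1 0 = n" "R1 (t + 1) = i" "I1 i R1 A1"
    show "runs (Cond (Less_test (t + 1) x) (For (t + 2) (Incr t)) (Copy x x)) (R1, A1)
      (1 + ((1 + (n * (1 + 2) + 1)) + 1))
      (\<lambda>(R', A'). R' 0 = n \<and> R' (t + 1) = i \<and> I1 (Suc i) (R'(t + 1 := Suc i)) A')"
    proof (rule runs_Cond)
      assume "holds (Less_test (t + 1) x) (R1, A1)"
      then have ix: "i < R x" using i Adj.prems by (simp add: I1_def)
      show "runs (For (t + 2) (Incr t)) (R1, A1) (1 + (n * (1 + 2) + 1))
        (\<lambda>(R', A'). R' 0 = n \<and> R' (t + 1) = i \<and> I1 (Suc i) (R'(t + 1 := Suc i)) A')"
      proof (rule runs_For[where I = "\<lambda>m R' A'. A' = A \<and> (\<forall>l<t. R' l = R l) \<and>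
          R' t = i * n + m \<and> R' (t + 1) = i"], goal_cases)
        case (4 j R2 A2)
        show ?case by (rule runs_Incr) (use 4 Adj.prems in auto)
      qed (use i ix Adj.prems in \<open>auto simp: I1_def\<close>)
    next
      assume "\<not> holds (Less_test (t + 1) x) (R1, A1)"
      then have ix: "\<not> i < R x" using i Adj.prems by (simp add: I1_def)
      show "runs (Copy x x) (R1, A1) 1
        (\<lambda>(R', A'). R' 0 = n \<and> R' (t + 1) = i \<and> I1 (Suc i) (R'(t + 1 := Suc i)) A')"
        by (rule runs_Copy) (use i ix Adj.prems in \<open>auto simp: I1_def\<close>)
    qed
  next
    fix R1 A1
    assume i: "R1 0 = n" "I1 n R1 A1"
    show "runs (Seq (For (t + 1) (Cond (Less_test (t + 1) y) (Incr t) (Copy x x))) (Load t 0 t))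
      (R1, A1) ((1 + (n * ((1 + (1 + 1)) + 2) + 1)) + 1) Q"
    proof (rule runs_Seq, rule runs_For[where I = I2])
      show "I2 0 (R1(t + 1 := 0)) A1" using i by (auto simp: I1_def I2_def min.commute)
    next
      fix j R2 A2
      assume j: "j < n" "R2 0 = n" "R2 (t + 1) = j" "I2 j R2 A2"
      then have "R2 y = R y" using Adj.prems by (simp add: I2_def)
      show "runs (Cond (Less_test (t + 1) y) (Incr t) (Copy x x)) (R2, A2) (1 + (1 + 1))
        (\<lambda>(R', A'). R' 0 = n \<and> R' (t + 1) = j \<and> I2 (Suc j) (R'(t + 1 := Suc j)) A')"
        by (rule runs_Cond, rule runs_Incr, rule_tac [2] runs_Copy)
          (use j \<open>R2 y = R y\<close> Adj.prems in \<open>auto simp: I2_def\<close>)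
    next
      fix R2 A2
      assume j: "R2 0 = n" "I2 n R2 A2"
      then have "A2 = A" by (simp add: I2_def)
      show "runs (Load t 0 t) (R2, A2) 1 Q" unfolding \<open>A2 = A\<close>
        by (rule runs_Load, rule Adj.prems) (use j Adj.prems in \<open>auto simp: I2_def min.commute\<close>)
    qed (use i in auto)
  qed (use Adj.prems in \<open>auto simp: I1_def\<close>)
next
  case (Cnt x e)
  \<comment> \<open>Register \<open>x\<close> is exempt because the loop is running over it; its old
    value waits in \<open>t\<close>.\<close>
  define I where "I i R' A' \<longleftrightarrow> A' = A \<and> (\<forall>l<t. l \<noteq> x \<longrightarrow> R' l = R l) \<and> R' t = R x \<and>
    R' (t + 1) = card {j. j < i \<and> val e (R(x := j)) A \<noteq> 0}"
    for i R' and A' :: "nat \<Rightarrow> nat \<Rightarrow> nat"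
  show ?case unfolding compile.simps tm.simps
  proof (rule runs_Seq, rule runs_Copy, rule runs_Seq, rule runs_Const, rule runs_Seq,
      rule runs_For[where I = I])
    fix i R1 A1
    assume i: "i < n" "R1 0 = n" "R1 x = i" "I i R1 A1"
    have v: "val e R1 A = val e (R(x := i)) A"
      by (rule val_cong[of t]) (use i Cnt.prems in \<open>auto simp: I_def\<close>)
    have A1: "A1 = A" using i by (simp add: I_def)
    show "runs (Seq (compile e (t + 2)) (Seq (Const (t + 3) 0)
        (Cond (Less_test (t + 3) (t + 2)) (Incr (t + 1)) (Copy x x)))) (R1, A1)
        (tm e n + (1 + (1 + (1 + 1))))
        (\<lambda>(R', A'). R' 0 = n \<and> R' x = i \<and> I (Suc i) (R'(x := Suc i)) A')"
      unfolding A1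
    proof (rule runs_Seq, rule Cnt.IH)
      show "wf_ex (t + 2) e" using Cnt.prems wf_ex_mono by force
    next
      fix R2 assume 2: "R2 (t + 2) = val e R1 A" "\<And>i. i < t + 2 \<Longrightarrow> R2 i = R1 i"
      show "runs (Seq (Const (t + 3) 0)
        (Cond (Less_test (t + 3) (t + 2)) (Incr (t + 1)) (Copy x x))) (R2, A)
        (1 + (1 + (1 + 1)))
        (\<lambda>(R', A'). R' 0 = n \<and> R' x = i \<and> I (Suc i) (R'(x := Suc i)) A')"
        by (rule runs_Seq, rule runs_Const, rule runs_Cond, rule runs_Incr, rule_tac [2] runs_Copy)
          (use i 2 v Cnt.prems in \<open>auto simp: I_def card_filter_Suc\<close>)
    qed (use i in auto)
  next
    fix R1 A1
    assume i: "R1 0 = n" "R1 x = n" "I n R1 A1"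
    then have "A1 = A" by (simp add: I_def)
    show "runs (Seq (Copy x t) (Copy t (t + 1))) (R1, A1) (1 + 1) Q" unfolding \<open>A1 = A\<close>
      by (rule runs_Seq, rule runs_Copy, rule runs_Copy, rule Cnt.prems)
        (use i Cnt.prems in \<open>auto simp: I_def\<close>)
  qed (use Cnt.prems in \<open>auto simp: I_def\<close>)
qed

subsection \<open>Digits in base \<open>c + 1\<close>\<close>

definition digit :: "nat \<Rightarrow> nat \<Rightarrow> nat \<Rightarrow> nat" where
  "digit c j i = j div (c + 1) ^ i mod (c + 1)"

lemma Suc_mod_eq_0_iff: "Suc (j mod Suc c) = Suc c \<longleftrightarrow> Suc c dvd Suc j"
  by (metis dvd_eq_mod_eq_0 mod_Suc mod_self old.nat.distinct(1))

text \<open>The lowest \<open>i\<close> digits are all maximal exactly when adding one carries out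
  of them.\<close>

lemma digits_all_max_iff: "(\<forall>l<i. digit c j l = c) \<longleftrightarrow> (c + 1) ^ i dvd j + 1"
proof (induction i)
  case (Suc i)
  show ?case
  proof (cases "(c + 1) ^ i dvd j + 1")
    case True
    define q where "q = j div (c + 1) ^ i"
    \<comment> \<open>\<open>j\<close> leaves the largest possible remainder, so adding one
      completes the block and raises the quotient \<open>q\<close> by one.\<close>
    have "j + 1 = (q + 1) * (c + 1) ^ i"
    proof -
      obtain r where r: "j + 1 = (c + 1) ^ i * r" using True by blast
      then have "r > 0" by (cases r) auto
      then obtain r' where r': "r = Suc r'" using gr0_conv_Suc by auto
      have "j = (c + 1) ^ i * r' + ((c + 1) ^ i - 1)"
        using r r' by (simp add: Suc_leI algebra_simps)
      moreover have "(c + 1) ^ i - 1 < (c + 1) ^ i" by simp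
      ultimately have "q = r'" unfolding q_def by (metis add_0_right div_less div_mult_self4 gr_implies_not0)
      then show ?thesis using r r' by (simp add: algebra_simps)
    qed
    then have "(c + 1) ^ Suc i dvd j + 1 \<longleftrightarrow> (c + 1) * (c + 1) ^ i dvd (q + 1) * (c + 1) ^ i"
      by (simp only: power_Suc)
    also have "\<dots> \<longleftrightarrow> (c + 1) dvd q + 1" by (rule dvd_times_right_cancel_iff) simp
    also have "(c + 1) dvd q + 1 \<longleftrightarrow> digit c j i = c"
      using Suc_mod_eq_0_iff[of q c] by (simp add: digit_def q_def)
    finally show ?thesis using Suc.IH True by (auto simp: less_Suc_eq)
  next
    case False
    then have "\<not> (c + 1) ^ Suc i dvd j + 1" by (metis dvd_mult_right power_Suc)
    then show ?thesis using Suc.IH False by (auto simp: less_Suc_eq)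
  qed
qed simp

text \<open>Each new digit depends only on the old digits up to its position, so the increment needs
  no carry variable. \<open>nextE\<close> evaluates exactly this formula.\<close>

lemma digit_Suc:
  "digit c (Suc j) i = (if \<forall>l<i. digit c j l = c
     then (if digit c j i < c then Suc (digit c j i) else 0) else digit c j i)"
proof -
  have "Suc j div (c + 1) ^ i = (if (c + 1) ^ i dvd j + 1 then Suc (j div (c + 1) ^ i) else j div (c + 1) ^ i)"
    by (simp add: div_Suc dvd_eq_mod_eq_0)
  moreover have "Suc x mod Suc c = (if x mod Suc c < c then Suc (x mod Suc c) else 0)" for x
    using mod_less_divisor[of "Suc c" x] unfolding mod_Suc[of x] by (simp del: mod_less_divisor)
  ultimately show ?thesis unfolding digits_all_max_iff by (simp add: digit_def)
qed

text \<open>A new leading digit contributes \<open>d m * (c + 1) ^ m\<close>, a multiple of each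
  \<open>(c + 1) ^ Suc i\<close> with \<open>i < m\<close>, and so does not disturb the lower
  digits.\<close>

lemma digits_surj:
  assumes "\<And>i. i < m \<Longrightarrow> d i \<le> c"
  shows "\<exists>j < (c + 1) ^ m. \<forall>i<m. digit c j i = d i"
  using assms
proof (induction m)
  case (Suc m)
  then obtain j where j: "j < (c + 1) ^ m" "\<forall>i<m. digit c j i = d i" by (meson less_SucI)
  let ?j = "j + d m * (c + 1) ^ m"
  have "digit c ?j i = d i" if "i < Suc m" for i
  proof (cases "i = m")
    case True
    then show ?thesis using j(1) Suc.prems[of m] by (simp add: digit_def)
  next
    case False
    then have "i < m" using that by simp
    then obtain l where l: "m = Suc l + i" by (metis add.commute add_Suc_right less_natE)
    have "?j = j + (d m * (c + 1) ^ l * (c + 1)) * (c + 1) ^ i"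
      by (simp add: l power_add algebra_simps)
    then have "?j div (c + 1) ^ i = j div (c + 1) ^ i + d m * (c + 1) ^ l * (c + 1)"
      using div_mult_self1[of "(c + 1) ^ i" j "d m * (c + 1) ^ l * (c + 1)"] by simp
    then have "digit c ?j i = digit c j i" unfolding digit_def by (metis mod_mult_self1)
    then show ?thesis using j \<open>i < m\<close> by simp
  qed
  moreover have "?j < (c + 1) ^ Suc m"
  proof -
    have "?j < (c + 1) ^ m + d m * (c + 1) ^ m" using j by simp
    also have "\<dots> \<le> (c + 1) ^ m + c * (c + 1) ^ m" using Suc.prems[of m] by simp
    finally show ?thesis by simp
  qed
  ultimately show ?case by blast
qed simp

text \<open>Inserting a new maximum changes no rank of a smaller element, and its own rank is the
  old cardinality.\<close>

lemma card_rank_less: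
  fixes C :: "nat set"
  assumes "finite C"
  shows "card {v \<in> C. card {w \<in> C. w < v} < i} = min i (card C)"
  using assms
proof (induction rule: finite_linorder_max_induct)
  case (insert b C)
  have b: "b \<notin> C" using insert.hyps by auto
  have "(card {w \<in> insert b C. w < v} < i) = (card {w \<in> C. w < v} < i)" if "v \<in> C" for v
  proof -
    have "{w \<in> insert b C. w < v} = {w \<in> C. w < v}" using insert.hyps that by force
    then show ?thesis by (rule arg_cong)
  qed
  then have 1: "{v \<in> C. card {w \<in> insert b C. w < v} < i} = {v \<in> C. card {w \<in> C. w < v} < i}"
    by blast
  have 2: "{w \<in> insert b C. w < b} = C" using insert.hyps by auto
  have 3: "{v \<in> insert b C. P v} = (if P b then insert b {v \<in> C. P v} else {v \<in> C. P v})" for P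
    by auto
  have "{v \<in> insert b C. card {w \<in> insert b C. w < v} < i} =
     (if card C < i then insert b {v \<in> C. card {w \<in> C. w < v} < i}
      else {v \<in> C. card {w \<in> C. w < v} < i})"
    unfolding 3[of "\<lambda>v. card {w \<in> insert b C. w < v} < i"] 1 2 ..
  then show ?case using insert.IH insert.hyps(1) b by simp
qed simp

subsection \<open>Twin classes\<close>

locale graph_on =
  fixes G :: "nat graph" and n :: nat
  assumes simple: "simple_graph G" and verts: "verts G = {..<n}"
begin

definition E :: "nat \<Rightarrow> nat \<Rightarrow> bool" where
  "E u v \<longleftrightarrow> {u, v} \<in> edges G"

definition twin :: "nat \<Rightarrow> nat \<Rightarrow> bool" where
  "twin u v \<longleftrightarrow> (\<forall>w<n. w \<noteq> u \<longrightarrow> w \<noteq> v \<longrightarrow> (E u w \<longleftrightarrow> E v w))"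

definition cl :: "nat \<Rightarrow> nat set" where
  "cl u = {v. v < n \<and> twin u v}"

definition rep :: "nat \<Rightarrow> bool" where
  "rep u \<longleftrightarrow> (\<forall>w<u. \<not> twin w u)"

definition reps :: "nat set" where
  "reps = {u. u < n \<and> rep u}"

text \<open>The position of the class of \<open>v\<close> when classes are ordered by their least
  vertices. Comparing \<open>u\<close> with all twins of \<open>v\<close> avoids computing that
  least vertex, and leaves a pure counting expression.\<close>

definition idx :: "nat \<Rightarrow> nat" where
  "idx v = card {u. u < n \<and> rep u \<and> (\<forall>w<n. twin w v \<longrightarrow> u < w)}"

lemma E_sym: "E u v \<longleftrightarrow> E v u"
  by (simp add: E_def insert_commute)

lemma E_irrefl: "\<not> E u u"
proof
  assume "E u u"
  then have "card {u, u} = 2" using simple unfolding E_def simple_graph_def by blast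
  then show False by simp
qed

lemma E_less: "E u v \<Longrightarrow> v < n"
  using simple verts unfolding E_def simple_graph_def by fastforce

lemma twin_refl: "twin u u"
  by (simp add: twin_def)

lemma twin_sym: "twin u v \<longleftrightarrow> twin v u"
  unfolding twin_def by metis

lemma twin_trans:
  assumes "twin u v" "twin v w" "u < n" "v < n" "w < n"
  shows "twin u w"
  unfolding twin_def
proof (intro allI impI)
  fix z assume z: "z < n" "z \<noteq> u" "z \<noteq> w"
  show "E u z \<longleftrightarrow> E w z"
  proof (cases "z = v \<and> u \<noteq> w")
    case True
    \<comment> \<open>The middle vertex is the one that neither hypothesis can be instantiated with.
      It is reached through the pair \<open>u\<close>, \<open>w\<close>: apply
      \<open>twin v w\<close> to \<open>u\<close>, then \<open>twin u v\<close> to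
      \<open>w\<close>.\<close>
    have "E u v \<longleftrightarrow> E w u"
      using assms True z E_sym unfolding twin_def by metis
    moreover have "E u w \<longleftrightarrow> E v w"
      using assms True z unfolding twin_def by metis
    ultimately show ?thesis using True E_sym by blast
  next
    case False
    then show ?thesis using assms z unfolding twin_def by metis
  qed
qed

lemma cl_eq_iff:
  assumes "u < n" "v < n"
  shows "cl u = cl v \<longleftrightarrow> twin u v"
proof
  assume "cl u = cl v"
  moreover have "v \<in> cl v" using assms twin_refl by (simp add: cl_def)
  ultimately show "twin u v" by (auto simp: cl_def)
next
  assume "twin u v"
  then have "twin u w \<longleftrightarrow> twin v w" if "w < n" for w
    using assms that twin_trans twin_sym by meson
  then show "cl u = cl v" by (auto simp: cl_def)
qed

lemma finite_cl: "finite (cl u)"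
  by (simp add: cl_def)

lemma nbhd_eq: "nbhd G u = {v. E u v}"
  using verts E_less by (auto simp: nbhd_def E_def)

text \<open>There are no loops, so \<open>u\<close> and \<open>v\<close> belong to neither of the
  two reduced neighbourhoods, and only the other vertices are compared.\<close>

lemma same_type_eq: "same_type G = {(u, v). u < n \<and> v < n \<and> twin u v}"
proof -
  have "nbhd G u - {v} = nbhd G v - {u} \<longleftrightarrow> twin u v" if "u < n" "v < n" for u v
    unfolding nbhd_eq twin_def set_eq_iff using E_irrefl E_less by (simp; metis)
  then show ?thesis using verts by (auto simp: same_type_def)
qed

lemma finite_reps: "finite reps"
  by (simp add: reps_def)

lemma card_reps_le: "card reps \<le> n"
  using card_mono[of "{..<n}" reps] by (auto simp: reps_def)

lemma least_twin:
  assumes "v < n"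
  obtains r where "r \<in> reps" "twin r v" "\<And>w. twin w v \<Longrightarrow> r \<le> w"
proof -
  define r where "r = (LEAST w. twin w v)"
  have r: "twin r v" unfolding r_def by (rule LeastI[of _ v]) (rule twin_refl)
  have least: "r \<le> w" if "twin w v" for w unfolding r_def using that by (rule Least_le)
  have "r < n" using least[OF twin_refl] assms by simp
  have "rep r" unfolding rep_def
    using twin_trans r \<open>r < n\<close> assms least by (meson less_trans not_le)
  then show ?thesis using that[of r] r least \<open>r < n\<close> by (simp add: reps_def)
qed

lemma nd_eq_card_reps: "nd G = card reps"
proof -
  have "verts G // same_type G = cl ` {..<n}"
    by (auto simp: quotient_def same_type_eq verts cl_def)
  also have "\<dots> = cl ` reps"
  proof -
    have "cl u \<in> cl ` reps" if "u < n" for u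
    proof -
      obtain r where r: "r \<in> reps" "twin r u" using least_twin[OF \<open>u < n\<close>] by blast
      moreover have "cl r = cl u" using cl_eq_iff r that by (simp add: reps_def)
      ultimately show ?thesis by (metis imageI)
    qed
    then show ?thesis by (auto simp: reps_def)
  qed
  finally have "nd G = card (cl ` reps)" by (simp add: nd_def)
  moreover have "inj_on cl reps"
  proof (rule inj_onI)
    fix u v assume "u \<in> reps" "v \<in> reps" "cl u = cl v"
    then have "twin u v" "rep u" "rep v" using cl_eq_iff by (auto simp: reps_def)
    then have "\<not> u < v" "\<not> v < u" using twin_sym by (auto simp: rep_def)
    then show "u = v" by simp
  qed
  ultimately show ?thesis by (simp add: card_image)
qed

lemma idx_cong:
  assumes "twin u v" "u < n" "v < n"
  shows "idx u = idx v"
proof -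
  have "twin w u \<longleftrightarrow> twin w v" if "w < n" for w
    using assms that twin_trans twin_sym by meson
  then have "(\<forall>w<n. twin w u \<longrightarrow> x < w) \<longleftrightarrow> (\<forall>w<n. twin w v \<longrightarrow> x < w)" for x by auto
  then show ?thesis unfolding idx_def by presburger
qed

lemma idx_eq_card_reps_less:
  assumes "v < n"
  obtains r where "r \<in> reps" "twin r v" "idx v = card {u \<in> reps. u < r}"
proof -
  obtain r where r: "r \<in> reps" "twin r v" and least: "\<And>w. twin w v \<Longrightarrow> r \<le> w"
    using least_twin[OF assms] by blast
  then have "r < n" by (simp add: reps_def)
  have "{u. u < n \<and> rep u \<and> (\<forall>w<n. twin w v \<longrightarrow> u < w)} = {u \<in> reps. u < r}"
    using r least \<open>r < n\<close> by (auto simp: reps_def intro: less_le_trans)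
  then show ?thesis using that[of r] r by (simp add: idx_def)
qed

lemma idx_less: "v < n \<Longrightarrow> idx v < card reps"
proof (erule idx_eq_card_reps_less)
  fix r assume "r \<in> reps" "idx v = card {u \<in> reps. u < r}"
  moreover have "card {u \<in> reps. u < r} < card reps"
    by (rule psubset_card_mono[OF finite_reps]) (use \<open>r \<in> reps\<close> in blast)
  ultimately show "idx v < card reps" by simp
qed

lemma idx_inj:
  assumes "u < n" "v < n" "idx u = idx v"
  shows "twin u v"
proof -
  obtain r where r: "r \<in> reps" "twin r u" "idx u = card {w \<in> reps. w < r}"
    using idx_eq_card_reps_less[OF assms(1)] .
  obtain s where s: "s \<in> reps" "twin s v" "idx v = card {w \<in> reps. w < s}"
    using idx_eq_card_reps_less[OF assms(2)] .
  have "card {w \<in> reps. w < x} < card {w \<in> reps. w < y}" if "x < y" "x \<in> reps" for x y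
    by (rule psubset_card_mono) (use finite_reps that in auto)
  then have "r = s" using r s assms(3) by (metis linorder_neqE_nat nat_neq_iff)
  then show ?thesis using r s assms twin_trans twin_sym unfolding reps_def by blast
qed

text \<open>The classes partition the vertices, so cardinalities are sums over classes. It serves
  both to compare common neighbourhoods and to compare the sizes of kept sets.\<close>

lemma card_mono_classes:
  assumes "W \<subseteq> {..<n}" "W' \<subseteq> {..<n}"
    and le: "\<And>u. u < n \<Longrightarrow> card (W \<inter> cl u) \<le> card (W' \<inter> cl u)"
  shows "card W \<le> card W'"
proof -
  have *: "card X = (\<Sum>C \<in> cl ` {..<n}. card (X \<inter> C))" if "X \<subseteq> {..<n}" for X
  proof -
    have "X = (\<Union>C \<in> cl ` {..<n}. X \<inter> C)" using that twin_refl by (auto simp: cl_def)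
    moreover have "card (\<Union>C \<in> cl ` {..<n}. X \<inter> C) = (\<Sum>C \<in> cl ` {..<n}. card (X \<inter> C))"
    proof (rule card_UN_disjoint)
      show "\<forall>C\<in>cl ` {..<n}. \<forall>D\<in>cl ` {..<n}. C \<noteq> D \<longrightarrow> X \<inter> C \<inter> (X \<inter> D) = {}"
      proof (intro ballI impI)
        fix C D assume "C \<in> cl ` {..<n}" "D \<in> cl ` {..<n}" "C \<noteq> D"
        then obtain u v where "u < n" "v < n" "C = cl u" "D = cl v" "\<not> twin u v"
          using cl_eq_iff by (metis imageE lessThan_iff)
        then show "X \<inter> C \<inter> (X \<inter> D) = {}"
          using twin_trans twin_sym unfolding cl_def by blast
      qed
    qed (auto simp: finite_cl)
    ultimately show ?thesis by simp
  qed
  show ?thesis unfolding *[OF assms(1)] *[OF assms(2)] by (rule sum_mono) (use le in auto)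
qed

section \<open>Closedness of the kept vertices and its transfer between kept sets\<close>

definition closed_on :: "nat \<Rightarrow> nat set \<Rightarrow> bool" where
  "closed_on c T \<longleftrightarrow> (\<forall>u\<in>T. \<forall>v\<in>T. u \<noteq> v \<longrightarrow> \<not> E u v \<longrightarrow> card {w \<in> T. E u w \<and> E v w} < c)"

lemma c_closed_delete_verts:
  assumes "c > 0"
  shows "c_closed c (delete_verts G S) \<longleftrightarrow> closed_on c ({..<n} - S)"
proof -
  have v: "verts (delete_verts G S) = {..<n} - S"
    using verts by (simp add: delete_verts_def verts_def)
  have e: "{u, w} \<in> edges (delete_verts G S) \<longleftrightarrow> E u w" if "u \<notin> S" "w \<notin> S" for u w
    using that by (simp add: delete_verts_def edges_def E_def)
  have "nbhd (delete_verts G S) u \<inter> nbhd (delete_verts G S) w =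
      {z \<in> {..<n} - S. E u z \<and> E w z}" if "u \<notin> S" "w \<notin> S" for u w
    using that e by (auto simp: nbhd_def v)
  moreover have "x \<le> c - 1 \<longleftrightarrow> x < c" for x using assms by auto
  ultimately show ?thesis unfolding c_closed_def closed_on_def v using e by auto
qed

lemma closed_vertex_deletion_iff:
  assumes "c > 0"
  shows "closed_vertex_deletion c G k \<longleftrightarrow>
    (\<exists>T \<subseteq> {..<n}. card ({..<n} - T) \<le> k \<and> closed_on c T)"
proof
  assume "closed_vertex_deletion c G k"
  then obtain S where S: "S \<subseteq> {..<n}" "card S \<le> k" "closed_on c ({..<n} - S)"
    using c_closed_delete_verts[OF assms] verts unfolding closed_vertex_deletion_def by auto
  moreover have "{..<n} - ({..<n} - S) = S" using S by auto
  ultimately show "\<exists>T \<subseteq> {..<n}. card ({..<n} - T) \<le> k \<and> closed_on c T"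
    by (intro exI[of _ "{..<n} - S"]) auto
next
  assume "\<exists>T \<subseteq> {..<n}. card ({..<n} - T) \<le> k \<and> closed_on c T"
  then obtain T where T: "T \<subseteq> {..<n}" "card ({..<n} - T) \<le> k" "closed_on c T" by blast
  moreover have "{..<n} - ({..<n} - T) = T" using T by auto
  ultimately show "closed_vertex_deletion c G k"
    unfolding closed_vertex_deletion_def using c_closed_delete_verts[OF assms] verts
    by (intro exI[of _ "{..<n} - T"]) auto
qed

lemma E_twin:
  assumes "twin u u'" "w \<noteq> u" "w \<noteq> u'" "w < n"
  shows "E u w \<longleftrightarrow> E u' w"
  using assms by (simp add: twin_def)

text \<open>If \<open>T\<close> keeps at least \<open>c\<close> vertices of a class, then in a \<open>c\<close>-closed graph that class is not
  contained in the common neighbourhood of a nonadjacent pair, so enlarging it does no harm. The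
  assumption \<open>c \<ge> 2\<close> provides two kept vertices of the class when both \<open>u\<close> and \<open>v\<close> belong to it.\<close>

lemma closed_on_transfer:
  assumes "c \<ge> 2" "T \<subseteq> {..<n}" "T' \<subseteq> {..<n}" "closed_on c T"
    and cards: "\<And>u. u < n \<Longrightarrow> card (T' \<inter> cl u) = card (T \<inter> cl u) \<or> c \<le> card (T \<inter> cl u)"
  shows "closed_on c T'"
  unfolding closed_on_def
proof (intro ballI impI)
  fix u v assume uv: "u \<in> T'" "v \<in> T'" "u \<noteq> v" "\<not> E u v"
  then have n: "u < n" "v < n" using assms by auto
  have finT: "finite (T \<inter> X)" "finite (T' \<inter> X)" for X
    using assms(2,3) by (meson finite_Int finite_lessThan finite_subset)+
  \<comment> \<open>Move the pair back into \<open>T\<close> by distinct twins. If \<open>u\<close>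
    and \<open>v\<close> are twins themselves, both replacements come from one class, which must
    then have two kept vertices.\<close>
  obtain u' v' where uv': "u' \<in> T" "v' \<in> T" "u' \<noteq> v'" "twin u u'" "twin v v'"
  proof (cases "twin u v")
    case True
    have "card {u, v} \<le> card (T' \<inter> cl u)"
      by (rule card_mono) (use finT uv n True twin_refl in \<open>auto simp: cl_def\<close>)
    then have "2 \<le> card (T \<inter> cl u)" using cards[OF n(1)] uv assms(1) by auto
    then obtain S where "S \<subseteq> T \<inter> cl u" "card S = 2" by (meson obtain_subset_with_card_n)
    then obtain a b where "a \<in> T \<inter> cl u" "b \<in> T \<inter> cl u" "a \<noteq> b" by (auto simp: card_2_iff)
    moreover have "cl u = cl v" using cl_eq_iff n True by blast
    ultimately show ?thesis using that[of a b] unfolding cl_def by blast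
  next
    case False
    have ex: "\<exists>a\<in>T. a < n \<and> twin x a" if "x \<in> T'" for x
    proof -
      have x: "x < n" using that assms by auto
      have "x \<in> T' \<inter> cl x" using that x twin_refl by (simp add: cl_def)
      then have "0 < card (T' \<inter> cl x)" using finT card_gt_0_iff by blast
      then have "0 < card (T \<inter> cl x)" using cards[OF x] assms(1) by auto
      then have "T \<inter> cl x \<noteq> {}" by (metis card.empty less_irrefl)
      then show ?thesis by (auto simp: cl_def)
    qed
    obtain a b where ab: "a \<in> T" "a < n" "twin u a" "b \<in> T" "b < n" "twin v b" using ex uv by blast
    then have "a \<noteq> b" using False twin_sym twin_trans n by blast
    then show ?thesis using that ab by blast
  qed
  have n': "u' < n" "v' < n" using uv' assms by auto
  have nE: "\<not> E u' v'"
  proof (cases "twin u v")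
    case True
    then have t: "twin u' v" "twin u' v'" "twin u v'" using uv' n n' twin_sym twin_trans by blast+
    show ?thesis
    \<comment> \<open>\<open>E_twin\<close> needs its third vertex distinct from both twins, so the
      two-step exchange fails when the replacement of \<open>v\<close> is \<open>u\<close> itself;
      one exchange suffices then.\<close>
    proof (cases "v' = u")
      case True
      then show ?thesis using uv uv' n n' t E_twin[of u' v u] E_sym by metis
    next
      case False
      then have "E u v' \<longleftrightarrow> E u' v'" using E_twin uv' n' by metis
      moreover have "E v u \<longleftrightarrow> E v' u" using E_twin uv uv' n False by metis
      ultimately show ?thesis using uv E_sym by blast
    qed
  next
    case False
    then have "v \<noteq> u'" "v' \<noteq> u" using uv' twin_sym by blast+
    then have "E u v \<longleftrightarrow> E u' v" "E v u' \<longleftrightarrow> E v' u'" using E_twin uv uv' n n' by metis+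
    then show ?thesis using uv E_sym by blast
  qed
  define W where "W = {w \<in> T. E u' w \<and> E v' w}"
  define W' where "W' = {w \<in> T'. E u w \<and> E v w}"
  have W: "card W < c" using assms(4) uv' nE unfolding closed_on_def W_def by blast
  have "card W' \<le> card W"
  proof (rule card_mono_classes)
    fix x assume x: "x < n"
    show "card (W' \<inter> cl x) \<le> card (W \<inter> cl x)"
    proof (cases "W' \<inter> cl x = {}")
      case False
      then obtain w where w: "w < n" "E u w" "E v w" "twin x w" by (auto simp: W'_def cl_def)
      have nt: "\<not> twin u w" "\<not> twin v w"
        using w uv E_twin[of u w v] E_twin[of v w u] E_sym E_irrefl n by metis+
      have "y \<in> W" if "y \<in> T \<inter> cl x" for y
      proof -
        have y: "y < n" "y \<in> T" "twin x y" using that by (auto simp: cl_def)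
        then have y2: "twin w y" using w x twin_sym twin_trans by blast
        have "\<not> twin u y" "\<not> twin v y" "\<not> twin u' w" "\<not> twin v' w" "\<not> twin u' y" "\<not> twin v' y"
          using nt y y2 w n n' uv' twin_sym twin_trans by meson+
        then have "u' \<noteq> w" "u' \<noteq> y" "v' \<noteq> w" "v' \<noteq> y" "u \<noteq> w" "v \<noteq> w"
          using twin_refl nt by blast+
        then have "E u' w" "E v' w" using E_twin w uv' by metis+
        then have "E u' y" "E v' y"
          using E_twin[OF y2, of u'] E_twin[OF y2, of v'] n' E_sym
            \<open>u' \<noteq> w\<close> \<open>u' \<noteq> y\<close> \<open>v' \<noteq> w\<close> \<open>v' \<noteq> y\<close> by metis+
        then show ?thesis using y by (simp add: W_def)
      qed
      \<comment> \<open>The whole kept part of this class lies in \<open>W\<close>, which has fewer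
        than \<open>c\<close> elements. This excludes the second alternative of
        \<open>cards\<close>, so \<open>T\<close> and \<open>T'\<close> keep equally many vertices
        here.\<close>
      then have sub: "T \<inter> cl x \<subseteq> W" by blast
      have "finite W" using finT(1)[of "{w. E u' w \<and> E v' w}"] by (simp add: W_def Int_def)
      then have "card (T \<inter> cl x) < c" using sub W card_mono by (meson le_less_trans)
      then have "card (T' \<inter> cl x) = card (T \<inter> cl x)" using cards[OF x] by auto
      moreover have "card (W' \<inter> cl x) \<le> card (T' \<inter> cl x)"
        by (rule card_mono) (use finT in \<open>auto simp: W'_def\<close>)
      moreover have "T \<inter> cl x = W \<inter> cl x" using sub by (auto simp: W_def)
      ultimately show ?thesis by simp
    qed simp
  qed (use assms in \<open>auto simp: W_def W'_def\<close>)
  then show "card {w \<in> T'. E u w \<and> E v w} < c" using W by (simp add: W'_def)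
qed

section \<open>Candidate sets encoded by digits\<close>

definition keep :: "nat \<Rightarrow> (nat \<Rightarrow> nat) \<Rightarrow> nat \<Rightarrow> bool" where
  "keep c d v \<longleftrightarrow> d (idx v) = c \<or> card {w. w < n \<and> w < v \<and> twin w v} < d (idx v)"

definition kept :: "nat \<Rightarrow> (nat \<Rightarrow> nat) \<Rightarrow> nat set" where
  "kept c d = {v. v < n \<and> keep c d v}"

lemma card_kept_class:
  assumes "u < n"
  shows "card (kept c d \<inter> cl u) =
    (if d (idx u) = c then card (cl u) else min (d (idx u)) (card (cl u)))"
proof -
  have i: "idx v = idx u" if "v \<in> cl u" for v
    using that assms idx_cong by (auto simp: cl_def)
  have r: "{w. w < n \<and> w < v \<and> twin w v} = {w \<in> cl u. w < v}" if "v \<in> cl u" for v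
    using that assms twin_sym twin_trans unfolding cl_def by blast
  have "kept c d \<inter> cl u = {v \<in> cl u. d (idx u) = c \<or> card {w \<in> cl u. w < v} < d (idx u)}"
    using i r by (auto simp: kept_def keep_def cl_def)
  then show ?thesis using card_rank_less[OF finite_cl, of u "d (idx u)"] by auto
qed

lemma closed_vertex_deletion_iff_digits:
  assumes "c \<ge> 2"
  shows "closed_vertex_deletion c G k \<longleftrightarrow>
    (\<exists>j < (c + 1) ^ nd G. card ({..<n} - kept c (digit c j)) \<le> k \<and> closed_on c (kept c (digit c j)))"
proof -
  have c0: "c > 0" using assms by simp
  show ?thesis unfolding closed_vertex_deletion_iff[OF c0]
  proof
    assume "\<exists>T \<subseteq> {..<n}. card ({..<n} - T) \<le> k \<and> closed_on c T"
    then obtain T where T: "T \<subseteq> {..<n}" "card ({..<n} - T) \<le> k" "closed_on c T" by blast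
    \<comment> \<open>\<open>d\<close> is indexed by class numbers, so an arbitrary vertex of the
      class is chosen; idx_inj makes the choice immaterial. Capping at \<open>c\<close> gives valid
      digits and turns every large class into the digit for "keep all".\<close>
    define d where "d i = min c (card (T \<inter> cl (SOME u. u < n \<and> idx u = i)))" for i
    have d: "d (idx u) = min c (card (T \<inter> cl u))" if "u < n" for u
    proof -
      define v where "v = (SOME v. v < n \<and> idx v = idx u)"
      have "v < n \<and> idx v = idx u" unfolding v_def by (rule someI[of _ u]) (use that in simp)
      then have "cl v = cl u" using idx_inj that cl_eq_iff by blast
      then show ?thesis by (simp add: d_def v_def)
    qed
    have "\<exists>j < (c + 1) ^ nd G. \<forall>i<nd G. digit c j i = d i"
      by (rule digits_surj) (simp add: d_def)
    then obtain j where j: "j < (c + 1) ^ nd G" "\<forall>i<nd G. digit c j i = d i" by blast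
    define T' where "T' = kept c (digit c j)"
    have sub: "T' \<subseteq> {..<n}" by (auto simp: T'_def kept_def)
    have cT': "card (T' \<inter> cl u) = (if c \<le> card (T \<inter> cl u) then card (cl u) else card (T \<inter> cl u))"
      if "u < n" for u
    proof -
      have "digit c j (idx u) = min c (card (T \<inter> cl u))"
        using j d that idx_less nd_eq_card_reps by simp
      moreover have "card (T \<inter> cl u) \<le> card (cl u)" by (rule card_mono) (auto simp: finite_cl)
      ultimately show ?thesis using card_kept_class[OF that, of c "digit c j"] T'_def by auto
    qed
    have "card T \<le> card T'"
    proof (rule card_mono_classes[OF T(1) sub])
      fix u assume "u < n"
      moreover have "card (T \<inter> cl u) \<le> card (cl u)" by (rule card_mono) (auto simp: finite_cl)
      ultimately show "card (T \<inter> cl u) \<le> card (T' \<inter> cl u)" using cT' by simp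
    qed
    then have "card ({..<n} - T') \<le> k"
      using T sub by (simp add: card_Diff_subset finite_subset[OF _ finite_lessThan])
    moreover have "closed_on c T'"
      by (rule closed_on_transfer[OF assms T(1) sub T(3)]) (simp add: cT')
    ultimately show "\<exists>j < (c + 1) ^ nd G. card ({..<n} - kept c (digit c j)) \<le> k \<and>
      closed_on c (kept c (digit c j))" using j by (auto simp: T'_def)
  next
    have "kept c d \<subseteq> {..<n}" for d by (auto simp: kept_def)
    then show "\<exists>j < (c + 1) ^ nd G. card ({..<n} - kept c (digit c j)) \<le> k \<and>
        closed_on c (kept c (digit c j)) \<Longrightarrow>
      \<exists>T \<subseteq> {..<n}. card ({..<n} - T) \<le> k \<and> closed_on c T" by blast
  qed
qed

end

subsection \<open>The algorithm\<close>

definition tr :: "ex \<Rightarrow> (nat \<Rightarrow> nat) \<Rightarrow> (nat \<Rightarrow> nat \<Rightarrow> nat) \<Rightarrow> bool" where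
  "tr e R A \<longleftrightarrow> val e R A \<noteq> 0"

definition NotE :: "ex \<Rightarrow> ex" where
  "NotE e = Ite e (N 0) (N 1)"

definition AndE :: "ex \<Rightarrow> ex \<Rightarrow> ex" where
  "AndE e e' = Ite e e' (N 0)"

definition OrE :: "ex \<Rightarrow> ex \<Rightarrow> ex" where
  "OrE e e' = Ite e (N 1) e'"

definition ImpE :: "ex \<Rightarrow> ex \<Rightarrow> ex" where
  "ImpE e e' = Ite e e' (N 1)"

definition IffE :: "ex \<Rightarrow> ex \<Rightarrow> ex" where
  "IffE e e' = Ite e e' (NotE e')"

definition EqE :: "ex \<Rightarrow> ex \<Rightarrow> ex" where
  "EqE e e' = AndE (NotE (Lt e e')) (NotE (Lt e' e))"

definition AllE :: "nat \<Rightarrow> ex \<Rightarrow> ex" where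
  "AllE x e = NotE (Cnt x (NotE e))"

lemmas ex_defs = NotE_def AndE_def OrE_def ImpE_def IffE_def EqE_def AllE_def

lemma tr_simps:
  "tr (NotE e) R A \<longleftrightarrow> \<not> tr e R A"
  "tr (AndE e e') R A \<longleftrightarrow> tr e R A \<and> tr e' R A"
  "tr (OrE e e') R A \<longleftrightarrow> tr e R A \<or> tr e' R A"
  "tr (ImpE e e') R A \<longleftrightarrow> (tr e R A \<longrightarrow> tr e' R A)"
  "tr (IffE e e') R A \<longleftrightarrow> (tr e R A \<longleftrightarrow> tr e' R A)"
  "tr (EqE e e') R A \<longleftrightarrow> val e R A = val e' R A"
  "tr (Lt e e') R A \<longleftrightarrow> val e R A < val e' R A"
  "tr (AllE x e) R A \<longleftrightarrow> (\<forall>i<R 0. tr e (R(x := i)) A)"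
  by (auto simp: tr_def ex_defs)

lemma val_Cnt: "val (Cnt x e) R A = card {i. i < R 0 \<and> tr e (R(x := i)) A}"
  by (simp add: tr_def)

lemma val_Ite: "val (Ite e e1 e0) R A = (if tr e R A then val e1 R A else val e0 R A)"
  by (simp add: tr_def)

declare val.simps(5,8)[simp del]

lemmas val_tr_simps = val.simps(1-4,6) val_Cnt val_Ite tr_simps

text \<open>Bound variables are actual registers. Nested expressions bind different ones, from 4
  upward, so that an inner count does not overwrite an argument; this is the origin of the
  inequalities assumed for \<open>x\<close> and \<open>y\<close> later.\<close>

definition twinE :: "nat \<Rightarrow> nat \<Rightarrow> ex" where
  "twinE x y = AllE 4 (ImpE (NotE (EqE (V 4) (V x))) (ImpE (NotE (EqE (V 4) (V y)))
     (IffE (Adj x 4) (Adj y 4))))"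

definition repE :: "nat \<Rightarrow> ex" where
  "repE x = AllE 5 (ImpE (Lt (V 5) (V x)) (NotE (twinE 5 x)))"

definition idxE :: "nat \<Rightarrow> ex" where
  "idxE x = Cnt 6 (AndE (repE 6) (AllE 7 (ImpE (twinE 7 x) (Lt (V 6) (V 7)))))"

definition keepE :: "nat \<Rightarrow> nat \<Rightarrow> ex" where
  "keepE c x = OrE (EqE (Ld 1 (idxE x)) (N c))
     (Lt (Cnt 8 (AndE (Lt (V 8) (V x)) (twinE 8 x))) (Ld 1 (idxE x)))"

definition okE :: "nat \<Rightarrow> ex" where
  "okE c = AndE (NotE (Lt (V 1) (Cnt 9 (NotE (keepE c 9)))))
     (AllE 9 (ImpE (keepE c 9) (AllE 10 (ImpE (keepE c 10) (ImpE (NotE (EqE (V 9) (V 10)))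
       (ImpE (NotE (Adj 9 10))
         (Lt (Cnt 11 (AndE (keepE c 11) (AndE (Adj 9 11) (Adj 10 11)))) (N c))))))))"

definition moreE :: "nat \<Rightarrow> ex" where
  "moreE c = NotE (AllE 9 (ImpE (Lt (V 9) (Cnt 6 (repE 6))) (EqE (Ld 1 (V 9)) (N c))))"

text \<open>Register 9 is free here: it holds the cell that \<open>Fill\<close> is about to
  write.\<close>

definition nextE :: "nat \<Rightarrow> ex" where
  "nextE c = Ite (AllE 10 (ImpE (Lt (V 10) (V 9)) (EqE (Ld 1 (V 10)) (N c))))
     (Ite (Lt (Ld 1 (V 9)) (N c)) (Sc (Ld 1 (V 9))) (N 0)) (Ld 1 (V 9))"

lemmas ex_defs' = ex_defs twinE_def repE_def idxE_def keepE_def okE_def moreE_def nextE_def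

definition Assign :: "nat \<Rightarrow> ex \<Rightarrow> prog" where
  "Assign r e = Seq (compile e 20) (Copy r 20)"

definition Fill :: "nat \<Rightarrow> ex \<Rightarrow> prog" where
  "Fill a e = For 9 (Seq (compile e 20) (Store a 9 20))"

lemma runs_Assign:
  assumes "wf_ex 20 e" "R 0 = n"
    and "\<And>R'. R' r = val e R A \<Longrightarrow> (\<And>i. i < 20 \<Longrightarrow> i \<noteq> r \<Longrightarrow> R' i = R i) \<Longrightarrow> Q (R', A)"
  shows "runs (Assign r e) (R, A) (tm e n + 1) Q"
  unfolding Assign_def
proof (rule runs_Seq, rule runs_compile[where n = n])
  fix R' assume "R' 20 = val e R A" "\<And>i. i < 20 \<Longrightarrow> R' i = R i"
  then show "runs (Copy r 20) (R', A) 1 Q" by (intro runs_Copy assms) auto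
qed (use assms in simp_all)

text \<open>Since \<open>e\<close> does not read array \<open>a\<close>, earlier stores cannot
  influence later values. This is why the counter is incremented into array 2 and then copied
  back.\<close>

lemma runs_Fill:
  assumes "wf_ex 20 e" "a \<notin> arrs e" "R 0 = n"
    and Q: "\<And>R' A'. (\<And>i. i < 20 \<Longrightarrow> i \<noteq> 9 \<Longrightarrow> R' i = R i) \<Longrightarrow> (\<And>b. b \<noteq> a \<Longrightarrow> A' b = A b) \<Longrightarrow>
      (\<And>i. i < n \<Longrightarrow> A' a i = val e (R(9 := i)) A) \<Longrightarrow> Q (R', A')"
  shows "runs (Fill a e) (R, A) (1 + (n * ((tm e n + 1) + 2) + 1)) Q"
proof -
  define I where "I l R' A' \<longleftrightarrow> (\<forall>i<20. i \<noteq> 9 \<longrightarrow> R' i = R i) \<and> (\<forall>b. b \<noteq> a \<longrightarrow> A' b = A b) \<and>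
    (\<forall>i<l. A' a i = val e (R(9 := i)) A)"
    for l R' and A' :: "nat \<Rightarrow> nat \<Rightarrow> nat"
  show ?thesis unfolding Fill_def
  proof (rule runs_For[where I = I])
    show "I 0 (R(9 := 0)) A" by (simp add: I_def)
  next
    fix l R1 A1 assume l: "l < n" "R1 0 = n" "R1 9 = l" "I l R1 A1"
    have v: "val e R1 A1 = val e (R(9 := l)) A"
      by (rule val_cong[OF assms(1)]) (use l assms(2) in \<open>auto simp: I_def\<close>)
    show "runs (Seq (compile e 20) (Store a 9 20)) (R1, A1) (tm e n + 1)
      (\<lambda>(R', A'). R' 0 = n \<and> R' 9 = l \<and> I (Suc l) (R'(9 := Suc l)) A')"
    proof (rule runs_Seq, rule runs_compile[where n = n])
      fix R2 assume 2: "R2 20 = val e R1 A1" "\<And>i. i < 20 \<Longrightarrow> R2 i = R1 i"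
      have "R2 9 = l" "R2 0 = n" using 2 l by auto
      then show "runs (Store a 9 20) (R2, A1) 1
        (\<lambda>(R', A'). R' 0 = n \<and> R' 9 = l \<and> I (Suc l) (R'(9 := Suc l)) A')"
        by (intro runs_Store) (use 2 l v in \<open>auto simp: I_def less_Suc_eq\<close>)
    qed (use assms l in simp_all)
  next
    fix R1 A1 assume "I n R1 A1"
    then show "Q (R1, A1)" by (intro Q) (auto simp: I_def)
  qed (use assms in auto)
qed

text \<open>Register 2 is the answer so far, register 3 tells whether to go on, and array 1 is the counter.
  Register 12 is never written and thus remains \<open>0\<close>. The temporary registers start at 20.\<close>

definition step_prog :: "nat \<Rightarrow> prog" where
  "step_prog c = Seq (Assign 2 (Ite (okE c) (N 1) (V 2))) (Seq (Assign 3 (Ite (moreE c) (N 1) (N 0)))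
     (Seq (Fill 2 (nextE c)) (Fill 1 (Ld 2 (V 9)))))"

definition step_tm :: "nat \<Rightarrow> nat \<Rightarrow> nat" where
  "step_tm c n = (tm (Ite (okE c) (N 1) (V 2)) n + 1) + ((tm (Ite (moreE c) (N 1) (N 0)) n + 1) +
     ((1 + (n * ((tm (nextE c) n + 1) + 2) + 1)) + (1 + (n * ((tm (Ld 2 (V 9)) n + 1) + 2) + 1))))"

definition main_prog :: "nat \<Rightarrow> prog" where
  "main_prog c = Seq (Const 3 1) (Seq (Loop (Less_test 12 3) (step_prog c)) (Copy 0 2))"

section \<open>Polynomial growth of the time bounds\<close>

definition polybd :: "(nat \<Rightarrow> nat) \<Rightarrow> bool" where
  "polybd f \<longleftrightarrow> (\<exists>K d. \<forall>n. f n \<le> K * (n + 1) ^ d)"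

lemma polybd_const: "polybd (\<lambda>_. m)"
  unfolding polybd_def by (intro exI[of _ m] exI[of _ 0]) simp

lemma polybd_id: "polybd (\<lambda>n. n)"
  unfolding polybd_def by (intro exI[of _ 1] exI[of _ 1]) simp

lemma polybd_add:
  assumes "polybd f" "polybd g"
  shows "polybd (\<lambda>n. f n + g n)"
proof -
  obtain K d K' d' where 1: "\<And>n. f n \<le> K * (n + 1) ^ d" "\<And>n. g n \<le> K' * (n + 1) ^ d'"
    using assms unfolding polybd_def by blast
  have "f n + g n \<le> (K + K') * (n + 1) ^ (d + d')" for n
  proof -
    have "(n + 1) ^ d \<le> (n + 1) ^ (d + d')" "(n + 1) ^ d' \<le> (n + 1) ^ (d + d')"
      by (intro power_increasing; simp)+
    then have "K * (n + 1) ^ d \<le> K * (n + 1) ^ (d + d')" "K' * (n + 1) ^ d' \<le> K' * (n + 1) ^ (d + d')"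
      by (intro mult_left_mono; simp)+
    then show ?thesis using 1[of n] unfolding distrib_right by linarith
  qed
  then show ?thesis unfolding polybd_def by blast
qed

lemma polybd_mult:
  assumes "polybd f" "polybd g"
  shows "polybd (\<lambda>n. f n * g n)"
proof -
  obtain K d K' d' where 1: "\<And>n. f n \<le> K * (n + 1) ^ d" "\<And>n. g n \<le> K' * (n + 1) ^ d'"
    using assms unfolding polybd_def by blast
  have "f n * g n \<le> (K * K') * (n + 1) ^ (d + d')" for n
  proof -
    have "f n * g n \<le> (K * (n + 1) ^ d) * (K' * (n + 1) ^ d')" using 1 by (rule mult_le_mono)
    then show ?thesis by (simp add: power_add mult_ac)
  qed
  then show ?thesis unfolding polybd_def by blast
qed

lemmas polybd_intros = polybd_const polybd_id polybd_add polybd_mult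

lemma polybd_tm: "polybd (tm e)"
proof (induction e)
  case (V x) then show ?case unfolding tm.simps[abs_def] by (intro polybd_intros)
next
  case (N m) then show ?case unfolding tm.simps[abs_def] by (intro polybd_intros)
next
  case (Sc e) then show ?case unfolding tm.simps[abs_def] by (intro polybd_intros)
next
  case (Lt e e') then show ?case unfolding tm.simps[abs_def] by (intro polybd_intros)
next
  case (Ite e e1 e0) then show ?case unfolding tm.simps[abs_def] by (intro polybd_intros)
next
  case (Ld a e) then show ?case unfolding tm.simps[abs_def] by (intro polybd_intros)
next
  case (Adj x y) then show ?case unfolding tm.simps[abs_def] by (intro polybd_intros)
next
  case (Cnt x e) then show ?case unfolding tm.simps[abs_def] by (intro polybd_intros)
qed

lemma polybd_imp_poly_bounded:
  assumes "polybd f"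
  shows "poly_bounded f"
proof -
  obtain K d where f: "\<And>n. f n \<le> K * (n + 1) ^ d" using assms unfolding polybd_def by blast
  have "real (f n) \<le> real (K * 2 ^ d) * real n ^ d" if "n \<ge> 1" for n
  proof -
    \<comment> \<open>Passing from \<open>n + 1\<close> to \<open>2 * n\<close> is possible from
      \<open>n = 1\<close> on and costs the factor \<open>2 ^ d\<close>.\<close>
    have "(n + 1) ^ d \<le> (2 * n) ^ d" by (rule power_mono) (use that in auto)
    then have "f n \<le> K * (2 * n) ^ d" using f[of n] by (meson mult_le_mono2 order_trans)
    then have "real (f n) \<le> real (K * (2 * n) ^ d)" by (rule of_nat_mono)
    then show ?thesis by (simp add: power_mult_distrib)
  qed
  then have "(\<lambda>n. real (f n)) \<in> O(\<lambda>n. real n ^ d)"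
    by (intro bigoI[of _ "real (K * 2 ^ d)"] eventually_mono[OF eventually_ge_at_top[of 1]]) simp
  then show ?thesis unfolding poly_bounded_def by blast
qed

section \<open>Meaning of the expressions on a graph, and the main loop\<close>

context graph_on
begin

definition adj :: "nat \<Rightarrow> nat" where
  "adj i = (if i < n * n \<and> {i div n, i mod n} \<in> edges G then 1 else 0)"

lemma adj_index:
  assumes "u < n" "v < n"
  shows "adj (u * n + v) \<noteq> 0 \<longleftrightarrow> E u v"
proof -
  have "u * n + v < Suc u * n" using assms by simp
  also have "\<dots> \<le> n * n" using assms by (intro mult_le_mono1) simp
  finally show ?thesis using assms by (simp add: adj_def E_def)
qed

definition good :: "(nat \<Rightarrow> nat) \<Rightarrow> (nat \<Rightarrow> nat \<Rightarrow> nat) \<Rightarrow> bool" where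
  "good R A \<longleftrightarrow> R 0 = n \<and> A 0 = adj"

lemma good_upd: "x \<noteq> 0 \<Longrightarrow> good R A \<Longrightarrow> good (R(x := i)) A"
  by (simp add: good_def)

lemma good_0: "good R A \<Longrightarrow> R 0 = n"
  by (simp add: good_def)

lemma tr_Adj:
  assumes "good R A" "R x < n" "R y < n"
  shows "tr (Adj x y) R A \<longleftrightarrow> E (R x) (R y)"
  using assms adj_index by (simp add: tr_def good_def min_absorb1)

lemmas tr_graph = val_tr_simps good_upd good_0 tr_Adj

lemma tr_twinE:
  assumes "good R A" "R x < n" "R y < n" "x \<noteq> 0" "y \<noteq> 0" "x \<noteq> 4" "y \<noteq> 4"
  shows "tr (twinE x y) R A \<longleftrightarrow> twin (R x) (R y)"
  using assms by (simp add: twinE_def tr_graph twin_def)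

lemma tr_repE:
  assumes "good R A" "R x < n" "x \<noteq> 0" "x \<noteq> 4" "x \<noteq> 5"
  shows "tr (repE x) R A \<longleftrightarrow> rep (R x)"
  using assms by (auto simp: repE_def tr_graph tr_twinE rep_def)

lemma val_idxE:
  assumes "good R A" "R x < n" "x \<notin> {0, 4, 5, 6, 7}"
  shows "val (idxE x) R A = idx (R x)"
  using assms by (simp add: idxE_def tr_graph tr_twinE tr_repE idx_def cong: conj_cong)

lemma tr_keepE:
  assumes "good R A" "R x < n" "x \<notin> {0, 4, 5, 6, 7, 8}"
  shows "tr (keepE c x) R A \<longleftrightarrow> keep c (A 1) (R x)"
  using assms by (simp add: keepE_def tr_graph tr_twinE val_idxE keep_def cong: conj_cong)

lemma tr_okE:
  assumes "good R A"
  shows "tr (okE c) R A \<longleftrightarrow>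
    card ({..<n} - kept c (A 1)) \<le> R 1 \<and> closed_on c (kept c (A 1))"
proof -
  have 1: "{i. i < n \<and> \<not> keep c (A 1) i} = {..<n} - kept c (A 1)" by (auto simp: kept_def)
  have 2: "{w \<in> kept c (A 1). E u w \<and> E v w} = {w. w < n \<and> keep c (A 1) w \<and> E u w \<and> E v w}" for u v
    by (auto simp: kept_def)
  have "tr (okE c) R A \<longleftrightarrow> \<not> R 1 < card {i. i < n \<and> \<not> keep c (A 1) i} \<and>
    (\<forall>u<n. keep c (A 1) u \<longrightarrow> (\<forall>v<n. keep c (A 1) v \<longrightarrow> u \<noteq> v \<longrightarrow> \<not> E u v \<longrightarrow>
      card {w. w < n \<and> keep c (A 1) w \<and> E u w \<and> E v w} < c))"
    using assms by (simp add: okE_def tr_graph tr_keepE cong: conj_cong)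
  then show ?thesis unfolding 1 closed_on_def 2 by (auto simp: kept_def)
qed

lemma tr_moreE:
  assumes "good R A"
  shows "tr (moreE c) R A \<longleftrightarrow> \<not> (\<forall>l<card reps. A 1 l = c)"
proof -
  have "tr (moreE c) R A \<longleftrightarrow> \<not> (\<forall>l<n. l < card reps \<longrightarrow> A 1 l = c)"
    using assms by (simp add: moreE_def tr_graph tr_repE reps_def cong: conj_cong)
  then show ?thesis using card_reps_le by auto
qed

lemma val_nextE:
  assumes "good R A" "l < n" "R 9 = l"
  shows "val (nextE c) R A = (if \<forall>i<l. A 1 i = c then (if A 1 l < c then Suc (A 1 l) else 0) else A 1 l)"
proof -
  have "(\<forall>i<n. i < l \<longrightarrow> A 1 i = c) \<longleftrightarrow> (\<forall>i<l. A 1 i = c)" using assms by auto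
  then show ?thesis using assms by (auto simp: nextE_def tr_graph)
qed

text \<open>Array 1 agrees with the digits only below \<open>n\<close>, which is enough because
  class numbers stay below \<open>card reps\<close>.\<close>

lemma kept_cong:
  assumes "\<And>i. i < n \<Longrightarrow> d i = d' i"
  shows "kept c d = kept c d'"
proof -
  have "d (idx v) = d' (idx v)" if "v < n" for v
    using assms idx_less[OF that] card_reps_le by simp
  then show ?thesis by (auto simp: kept_def keep_def)
qed

definition solution :: "nat \<Rightarrow> nat \<Rightarrow> nat \<Rightarrow> bool" where
  "solution c k j \<longleftrightarrow> card ({..<n} - kept c (digit c j)) \<le> k \<and> closed_on c (kept c (digit c j))"

text \<open>\<open>j\<close> is the value represented by the counter. All \<open>n\<close> cells are
  maintained, although only the first \<open>nd G\<close> of them are digits of classes.\<close>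

definition loop_inv :: "nat \<Rightarrow> nat \<Rightarrow> nat \<Rightarrow> state \<Rightarrow> bool" where
  "loop_inv c k j = (\<lambda>(R, A). good R A \<and> R 1 = k \<and> R 12 = 0 \<and>
     R 2 = (if \<exists>i<j. solution c k i then 1 else 0) \<and>
     R 3 = (if j < (c + 1) ^ nd G then 1 else 0) \<and> (\<forall>i<n. A 1 i = digit c j i))"

lemma runs_step_prog:
  assumes "loop_inv c k j (R, A)" "j < (c + 1) ^ nd G"
  shows "runs (step_prog c) (R, A) (step_tm c n) (loop_inv c k (Suc j))"
proof -
  have inv: "good R A" "R 1 = k" "R 12 = 0" "R 2 = (if \<exists>i<j. solution c k i then 1 else 0)"
    "R 0 = n" "\<And>i. i < n \<Longrightarrow> A 1 i = digit c j i"
    using assms by (auto simp: loop_inv_def good_def)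
  have kept: "kept c (A 1) = kept c (digit c j)" by (rule kept_cong) (rule inv)
  have ok: "tr (okE c) R A \<longleftrightarrow> solution c k j"
    unfolding tr_okE[OF inv(1)] kept solution_def inv(2) ..
  show ?thesis unfolding step_prog_def step_tm_def
  proof (rule runs_Seq, rule runs_Assign)
    fix R1 assume 1: "R1 2 = val (Ite (okE c) (N 1) (V 2)) R A" "\<And>i. i < 20 \<Longrightarrow> i \<noteq> 2 \<Longrightarrow> R1 i = R i"
    have good1: "good R1 A" using inv(1) 1(2)[of 0] by (simp add: good_def)
    have R12: "R1 2 = (if \<exists>i<Suc j. solution c k i then 1 else 0)"
      unfolding 1(1) val_Ite ok using inv(4) by (auto simp: less_Suc_eq)
    show "runs (Seq (Assign 3 (Ite (moreE c) (N 1) (N 0))) (Seq (Fill 2 (nextE c)) (Fill 1 (Ld 2 (V 9)))))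
      (R1, A) ((tm (Ite (moreE c) (N 1) (N 0)) n + 1) +
     ((1 + (n * ((tm (nextE c) n + 1) + 2) + 1)) + (1 + (n * ((tm (Ld 2 (V 9)) n + 1) + 2) + 1))))
      (loop_inv c k (Suc j))"
    proof (rule runs_Seq, rule runs_Assign)
      fix R2 assume 2: "R2 3 = val (Ite (moreE c) (N 1) (N 0)) R1 A" "\<And>i. i < 20 \<Longrightarrow> i \<noteq> 3 \<Longrightarrow> R2 i = R1 i"
      have good2: "good R2 A" using good1 2(2)[of 0] by (simp add: good_def)
      have "(\<forall>l<card reps. A 1 l = c) \<longleftrightarrow> (\<forall>l<card reps. digit c j l = c)"
        using inv(6) card_reps_le by simp
      \<comment> \<open>As \<open>j + 1\<close> is positive and at most
        \<open>(c + 1) ^ nd G\<close>, divisibility forces equality: maximal class digits mean that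
        \<open>j\<close> is the last choice.\<close>
      also have "\<dots> \<longleftrightarrow> (c + 1) ^ nd G dvd j + 1"
        unfolding digits_all_max_iff nd_eq_card_reps ..
      also have "\<dots> \<longleftrightarrow> \<not> Suc j < (c + 1) ^ nd G"
      proof
        assume "(c + 1) ^ nd G dvd j + 1"
        then have "(c + 1) ^ nd G \<le> j + 1" by (rule dvd_imp_le) simp
        then show "\<not> Suc j < (c + 1) ^ nd G" by simp
      next
        assume "\<not> Suc j < (c + 1) ^ nd G"
        then have "j + 1 = (c + 1) ^ nd G" using assms(2) by simp
        then show "(c + 1) ^ nd G dvd j + 1" by simp
      qed
      finally have R23: "R2 3 = (if Suc j < (c + 1) ^ nd G then 1 else 0)"
        unfolding 2(1) val_Ite tr_moreE[OF good1] by simp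
      show "runs (Seq (Fill 2 (nextE c)) (Fill 1 (Ld 2 (V 9)))) (R2, A)
        ((1 + (n * ((tm (nextE c) n + 1) + 2) + 1)) + (1 + (n * ((tm (Ld 2 (V 9)) n + 1) + 2) + 1)))
        (loop_inv c k (Suc j))"
      proof (rule runs_Seq, rule runs_Fill)
        fix R3 A3
        assume 3: "\<And>i. i < 20 \<Longrightarrow> i \<noteq> 9 \<Longrightarrow> R3 i = R2 i" "\<And>b. b \<noteq> 2 \<Longrightarrow> A3 b = A b"
          "\<And>i. i < n \<Longrightarrow> A3 2 i = val (nextE c) (R2(9 := i)) A"
        have d: "A3 2 i = digit c (Suc j) i" if "i < n" for i
        proof -
          have eq: "(\<forall>l<i. A 1 l = c) \<longleftrightarrow> (\<forall>l<i. digit c j l = c)" using inv(6) that by simp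
          have "good (R2(9 := i)) A" using good2 by (simp add: good_upd)
          note v = val_nextE[OF this that]
          show ?thesis unfolding 3(3)[OF that] by (subst v) (simp_all only: eq inv(6)[OF that] digit_Suc fun_upd_same)
        qed
        show "runs (Fill 1 (Ld 2 (V 9))) (R3, A3) (1 + (n * ((tm (Ld 2 (V 9)) n + 1) + 2) + 1))
          (loop_inv c k (Suc j))"
        proof (rule runs_Fill)
          fix R4 A4
          assume 4: "\<And>i. i < 20 \<Longrightarrow> i \<noteq> 9 \<Longrightarrow> R4 i = R3 i" "\<And>b. b \<noteq> 1 \<Longrightarrow> A4 b = A3 b"
            "\<And>i. i < n \<Longrightarrow> A4 1 i = val (Ld 2 (V 9)) (R3(9 := i)) A3"
          have "R4 i = R2 i" if "i \<in> {0, 1, 2, 3, 12}" for i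
            using that 4(1)[of i] 3(1)[of i] by auto
          moreover have "R2 0 = n" "R2 1 = k" "R2 2 = R1 2" "R2 12 = 0"
            using 1(2) 2(2) inv by auto
          moreover have "A4 0 = adj" using 4(2)[of 0] 3(2)[of 0] inv(1) by (simp add: good_def)
          moreover have "A4 1 i = digit c (Suc j) i" if "i < n" for i
            using 4(3)[OF that] d[OF that] by simp
          ultimately show "loop_inv c k (Suc j) (R4, A4)"
            using R12 R23 by (simp add: loop_inv_def good_def)
        next
          show "R3 0 = n" using 3(1)[of 0] good2 by (simp add: good_def)
        qed simp_all
      next
        show "R2 0 = n" using good2 by (simp add: good_def)
      qed (simp_all add: ex_defs')
    next
      show "R1 0 = n" using good1 by (simp add: good_def)
    qed (simp add: ex_defs')
  qed (simp_all add: ex_defs' inv)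
qed

lemma input_state_eq: "input_state G k = ((\<lambda>_. 0)(0 := n, 1 := k), (\<lambda>_ _. 0)(0 := adj))"
  by (simp add: input_state_def verts adj_def[abs_def] Let_def)

lemma runs_main_prog:
  assumes "c \<ge> 2"
  shows "runs (main_prog c) (input_state G k) (1 + ((((c + 1) ^ nd G - 0) * (step_tm c n + 1) + 1) + 1))
    (\<lambda>(R, A). R 0 = (if closed_vertex_deletion c G k then 1 else 0))"
  unfolding main_prog_def input_state_eq
proof (rule runs_Seq, rule runs_Const, rule runs_Seq,
    rule runs_Loop[where I = "loop_inv c k" and j = 0 and N = "(c + 1) ^ nd G"])
  \<comment> \<open>The zeroed array already represents the choice \<open>0\<close>, and there is
    always at least one choice, so register 3 may start as \<open>1\<close> even for the empty
    graph.\<close>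
  show "loop_inv c k 0 ((((\<lambda>_. 0)(0 := n, 1 := k))(3 := 1), (\<lambda>_ _. 0)(0 := adj)))"
    by (simp add: loop_inv_def good_def digit_def)
next
  fix j s assume j: "j < (c + 1) ^ nd G" "loop_inv c k j s"
  obtain R A where s: "s = (R, A)" by force
  then have "holds (Less_test 12 3) s" using j by (simp add: loop_inv_def)
  then show "holds (Less_test 12 3) s \<and> runs (step_prog c) s (step_tm c n) (loop_inv c k (Suc j))"
    using runs_step_prog j s by blast
next
  fix s assume j: "loop_inv c k ((c + 1) ^ nd G) s"
  obtain R A where s: "s = (R, A)" by force
  have "R 2 = (if closed_vertex_deletion c G k then 1 else 0)"
    using j closed_vertex_deletion_iff_digits[OF assms] by (simp add: s loop_inv_def solution_def)
  then have "runs (Copy 0 2) s 1 (\<lambda>(R, A). R 0 = (if closed_vertex_deletion c G k then 1 else 0))"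
    unfolding s by (intro runs_Copy) simp
  then show "\<not> holds (Less_test 12 3) s \<and>
      runs (Copy 0 2) s 1 (\<lambda>(R, A). R 0 = (if closed_vertex_deletion c G k then 1 else 0))"
    using j by (simp add: s loop_inv_def)
qed simp

end

theorem theorem7:
  fixes c :: nat
  assumes "c \<ge> 2"
  shows "\<exists>p f. poly_bounded f \<and>
    solves_within p (closed_vertex_deletion c) (\<lambda>G. (c + 1) ^ nd G * f (card (verts G)))"
proof (intro exI conjI)
  \<comment> \<open>Each round costs one loop test besides \<open>step_tm\<close>. The other three
    steps, for the initial \<open>Const\<close>, the failing test and the final \<open>Copy\<close>,
    are absorbed because there is at least one round.\<close>
  show "poly_bounded (\<lambda>n. step_tm c n + 4)"
    unfolding step_tm_def by (intro polybd_imp_poly_bounded polybd_intros polybd_tm)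
  show "solves_within (main_prog c) (closed_vertex_deletion c)
    (\<lambda>G. (c + 1) ^ nd G * (step_tm c (card (verts G)) + 4))"
    unfolding solves_within_def
  proof (intro allI impI)
    fix G :: "nat graph" and k
    assume G: "simple_graph G" "verts G = {..<card (verts G)}"
    define n where "n = card (verts G)"
    interpret graph_on G n using G by unfold_locales (simp_all add: n_def)
    obtain t s where t: "exec (main_prog c) (input_state G k) t s"
      "t \<le> 1 + ((((c + 1) ^ nd G - 0) * (step_tm c n + 1) + 1) + 1)"
      "(\<lambda>(R, A). R 0 = (if closed_vertex_deletion c G k then 1 else 0)) s"
      using runs_main_prog[OF assms, of k] unfolding runs_def by blast
    obtain R A where s: "s = (R, A)" by force
    have "(c + 1) ^ nd G \<ge> 1" by simp
    then have "t \<le> (c + 1) ^ nd G * (step_tm c n + 4)"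
      using t(2) unfolding distrib_left minus_nat.diff_0 by linarith
    then show "\<exists>t R A. exec (main_prog c) (input_state G k) t (R, A) \<and>
        t \<le> (c + 1) ^ nd G * (step_tm c (card (verts G)) + 4) \<and>
        R 0 = (if closed_vertex_deletion c G k then 1 else 0)"
      using t(1,3) s unfolding n_def by (intro exI[of _ t] exI[of _ R] exI[of _ A]) simp
  qed
qed


end
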